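(* Let $\gamma\in\{1,-1\}$, $\sigma\in(1,3/2]$, and let $a_n>0$, $b_n\in\mathbb R$ satisfy, as $n\to\infty$, $$a_n=n^\sigma(1+\alpha n^{-1}+O(n^{-2})),\qquad b_n=2\gamma n^\sigma(1+\beta n^{-1}+O(n^{-2})),$$ with $\alpha,\beta\in\mathbb R$; put $\tau=2\beta-2\alpha+\sigma$ and assume $\tau\neq0$. Set $\rho=\sigma/2-1/4$, $t_n(z)=-\tau n^{-1}+zn^{-\sigma}$ and $\theta_n(z)=\sqrt{t_n(z)}$ for $n\ge1$. (i) Let $\tau<0$ and $\varphi_n(z)=\sum_{m=1}^n\theta_m(z)$. Then for every $z$ in the complex plane cut along $\mathbb R$ (both edges $\lambda\pm i0$, $\lambda\in\mathbb R$, of the cut included) the equation $$a_{n-1}F_{n-1}+b_nF_n+a_nF_{n+1}=zF_n,\qquad n\ge1,$$ has a solution $f_n(z)$ such that $$f_n(z)=(-\gamma)^n n^{-\rho}e^{i\varphi_n(\gamma z)}(1+o(1)),\qquad n\to\infty.$$ For all $n\in\mathbb Z_+$ the functions $f_n(z)$ are analytic in $\mathbb C\setminus\mathbb R$ and continuous up to the cut along $\mathbb R$. The asymptotic formula is uniform in $z$ from compact subsets of the closed cut plane. (ii) Let $\tau>0$. Then for every $z\in\mathbb C$ the same equation has a solution $f_n(z)$ such that for all $n\in\mathbb Z_+$ the function $f_n(z)$ is analytic in the whole complex plane, and the following holds: for every $R>0$ and every integer $N\ge1$ with $\tau N^{\sigma-1}>R$, there is a nowhere vanishing analytic function $C(z)$,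 $|z|<R$, such that $$f_n(z)=C(z)(-\gamma)^n n^{-\rho}e^{i\varphi_n(\gamma z)}(1+o(1)),\quad n\to\infty,\qquad \varphi_n(z)=\sum_{m=N}^n\theta_m(z),$$ for all $|z|<R$, uniformly in $z$ from compact subsets of the disc $|z|<R$.
   Context: $\mathbb Z_+=\{0,1,2,\dots\}$. The function $\sqrt t$ is the analytic branch on $\mathbb C\setminus[0,\infty)$ with $\Im\sqrt t>0$, and $\sqrt{t\pm i0}=\pm|t|^{1/2}$ for $t>0$ on the edges of the cut. Functions of $z$ at the edge points $\lambda\pm i0$ are understood as limits from the upper/lower half-plane (so $t_n(\lambda\pm i0)=t_n(\lambda)\pm i0$); multiplication by $\gamma=-1$ maps $\lambda\pm i0$ to $(-\lambda)\mp i0$. "Continuous up to the cut" means that the function has continuous extensions from the upper and from the lower half-plane to $\mathbb R$ (the two extensions may differ). *)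

theory Defs
  imports "HOL-Complex_Analysis.Complex_Analysis"
begin

section \<open>The complex plane closed up along a cut\<close>

text \<open>
  A pair \<open>(s, z)\<close> stands for the point \<open>z\<close> seen from the closed upper (\<open>s = True\<close>) or the closed
  lower (\<open>s = False\<close>) half-plane; thus for real \<open>x\<close> the pairs \<open>(True, x)\<close> and \<open>(False, x)\<close> are the
  edge points \<open>x + i0\<close> and \<open>x - i0\<close>, and a non-real \<open>z\<close> is represented only by \<open>(0 < Im z, z)\<close>.
  Since \<open>bool\<close> is discrete, the product topology makes the plane cut along the whole real line,
  with both edges included, the disjoint union of the two closed half-planes.
\<close>

definition closed_cut_plane :: "(bool \<times> complex) set" where
  "closed_cut_plane = {(s, z). if s then 0 \<le> Im z else Im z \<le> 0}"

text \<open>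
  Analytic in the complement of the real line, with continuous extensions to the real line from
  above and from below, the values of which are the values at the edge points.
\<close>

definition analytic_continuous_up_to_cut :: "(bool \<times> complex \<Rightarrow> complex) \<Rightarrow> bool" where
  "analytic_continuous_up_to_cut f \<longleftrightarrow>
     (\<lambda>z. f (0 < Im z, z)) holomorphic_on {z. Im z \<noteq> 0} \<and> continuous_on closed_cut_plane f"

text \<open>Multiplication by \<open>\<gamma> \<in> {1, -1}\<close>; multiplication by \<open>-1\<close> interchanges the half-planes.\<close>

definition cut_mult :: "real \<Rightarrow> bool \<times> complex \<Rightarrow> bool \<times> complex" where
  "cut_mult \<gamma> p = (if 0 < \<gamma> then fst p else \<not> fst p, of_real \<gamma> * snd p)"


section \<open>The branch of the square root with positive imaginary part\<close>

text \<open>Only meant for \<open>t\<close> outside \<open>[0, \<infinity>)\<close>, see \<open>branch_sqrt_iff\<close> below.\<close>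

definition branch_sqrt :: "complex \<Rightarrow> complex" where
  "branch_sqrt t = \<i> * csqrt (- t)"

definition branch_sqrt_cut :: "bool \<times> complex \<Rightarrow> complex" where
  "branch_sqrt_cut p =
     (if snd p \<in> \<real>\<^sub>\<ge>\<^sub>0
      then (if fst p then 1 else - 1) * of_real (sqrt (Re (snd p)))
      else branch_sqrt (snd p))"

lemma branch_sqrt_iff:
  assumes "t \<notin> \<real>\<^sub>\<ge>\<^sub>0"
  shows "w = branch_sqrt t \<longleftrightarrow> w\<^sup>2 = t \<and> 0 < Im w"
proof -
  have 1: "(branch_sqrt t)\<^sup>2 = t"
    by (simp add: branch_sqrt_def power_mult_distrib)
  have "Re (csqrt (- t)) \<noteq> 0"
  proof
    assume "Re (csqrt (- t)) = 0"
    hence "Im ((csqrt (- t))\<^sup>2) = 0" "Re ((csqrt (- t))\<^sup>2) = - ((Im (csqrt (- t)))\<^sup>2)"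
      by (simp_all only: Re_power2 Im_power2)
         (simp_all only: mult_zero_left mult_zero_right power_zero_numeral diff_0)
    hence "Im t = 0" "Re t = (Im (csqrt (- t)))\<^sup>2"
      unfolding power2_csqrt by (simp_all only: uminus_complex.sel neg_equal_iff_equal neg_equal_0_iff_equal)
    hence "t \<in> \<real>\<^sub>\<ge>\<^sub>0" by (simp only: complex_nonneg_Reals_iff zero_le_power2 simp_thms)
    thus False using assms by simp
  qed
  hence 2: "0 < Im (branch_sqrt t)"
    using Re_csqrt[of "- t"] by (simp add: branch_sqrt_def)
  show ?thesis
  proof
    assume "w = branch_sqrt t" thus "w\<^sup>2 = t \<and> 0 < Im w" using 1 2 by simp
  next
    assume w: "w\<^sup>2 = t \<and> 0 < Im w"
    hence "w = branch_sqrt t \<or> w = - branch_sqrt t" using 1 by (metis power2_eq_iff)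
    thus "w = branch_sqrt t"
    proof
      assume "w = - branch_sqrt t"
      hence "Im w = - Im (branch_sqrt t)" by (simp only: uminus_complex.sel)
      thus ?thesis using w 2 by linarith
    qed
  qed
qed

lemma holomorphic_branch_sqrt: "branch_sqrt holomorphic_on - \<real>\<^sub>\<ge>\<^sub>0"
  unfolding branch_sqrt_def
  by (intro holomorphic_intros) (auto simp: complex_nonneg_Reals_iff complex_nonpos_Reals_iff)

lemma branch_sqrt_cut_upper: "0 \<le> Im t \<Longrightarrow> branch_sqrt_cut (True, t) = csqrt t"
proof (cases "t \<in> \<real>\<^sub>\<ge>\<^sub>0")
  case False
  assume "0 \<le> Im t"
  have "Im (csqrt t) \<ge> 0"
    using \<open>0 \<le> Im t\<close> using complex_Re_le_cmod[of t] by (simp add: sgn_if)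
  moreover have "Im (csqrt t) \<noteq> 0" using False Im_csqrt_eq_0_iff by blast
  ultimately have "0 < Im (csqrt t)" by linarith
  hence "csqrt t = branch_sqrt t" unfolding branch_sqrt_iff[OF False] by (simp only: power2_csqrt simp_thms)
  thus ?thesis using False by (simp add: branch_sqrt_cut_def)
qed (auto simp: branch_sqrt_cut_def complex_nonneg_Reals_iff)

lemma branch_sqrt_cut_lower: "Im t \<le> 0 \<Longrightarrow> branch_sqrt_cut (False, t) = branch_sqrt t"
  by (auto simp: branch_sqrt_cut_def branch_sqrt_def complex_nonneg_Reals_iff
      simp flip: mult.assoc)

lemma continuous_on_csqrt_upper: "continuous_on {t. 0 \<le> Im t} csqrt"
  unfolding continuous_on_eq_continuous_within
proof safe
  fix t :: complex assume t: "0 \<le> Im t"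
  consider "t = 0" | "t \<noteq> 0" "t \<notin> \<real>\<^sub>\<le>\<^sub>0" | "t \<noteq> 0" "t \<in> \<real>\<^sub>\<le>\<^sub>0" by blast
  thus "continuous (at t within {t. 0 \<le> Im t}) csqrt"
  proof cases
    case 1
    have "((\<lambda>x. sqrt (norm x)) \<longlongrightarrow> sqrt (norm (0::complex))) (at 0 within {t. 0 \<le> Im t})"
      by (intro tendsto_intros)
    hence "((\<lambda>x. norm (csqrt x)) \<longlongrightarrow> 0) (at 0 within {t. 0 \<le> Im t})" by simp
    thus ?thesis unfolding 1 continuous_within csqrt_0 by (rule tendsto_norm_zero_cancel)
  next
    case 2
    thus ?thesis by (intro continuous_within_csqrt)
  next
    case 3
    have *: "csqrt x = branch_sqrt x" if "0 \<le> Im x" "x \<notin> \<real>\<^sub>\<ge>\<^sub>0" for x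
      using that branch_sqrt_cut_upper[of x] by (simp add: branch_sqrt_cut_def)
    have t': "t \<in> - \<real>\<^sub>\<ge>\<^sub>0"
      using 3 by (auto simp: complex_nonneg_Reals_iff complex_nonpos_Reals_iff complex_eq_iff)
    have "open (- \<real>\<^sub>\<ge>\<^sub>0 :: complex set)" by (simp add: open_Compl)
    hence ev: "\<forall>\<^sub>F x in at t within {t. 0 \<le> Im t}. x \<in> - \<real>\<^sub>\<ge>\<^sub>0 \<and> x \<in> {t. 0 \<le> Im t}"
      using t' by (auto simp: eventually_at_filter intro: eventually_mono[OF eventually_nhds_in_open])
    have "continuous (at t within {t. 0 \<le> Im t}) branch_sqrt"
      using holomorphic_branch_sqrt t' \<open>open (- \<real>\<^sub>\<ge>\<^sub>0)\<close>
      by (meson continuous_at_imp_continuous_at_within continuous_on_eq_continuous_at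
          holomorphic_on_imp_continuous_on)
    hence "(branch_sqrt \<longlongrightarrow> csqrt t) (at t within {t. 0 \<le> Im t})"
      using *[OF t] t' by (simp add: continuous_within)
    hence "(csqrt \<longlongrightarrow> csqrt t) (at t within {t. 0 \<le> Im t})"
      by (rule Lim_transform_eventually) (use ev in \<open>auto elim!: eventually_mono simp: *\<close>)
    thus ?thesis by (simp add: continuous_within)
  qed
qed

lemma continuous_on_closed_cut_plane_iff:
  fixes f :: "bool \<times> complex \<Rightarrow> 'a :: topological_space"
  shows "continuous_on closed_cut_plane f \<longleftrightarrow>
    continuous_on {z. 0 \<le> Im z} (\<lambda>z. f (True, z)) \<and>
    continuous_on {z. Im z \<le> 0} (\<lambda>z. f (False, z))" (is "?L \<longleftrightarrow> ?R")
proof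
  assume L: ?L
  show ?R
    by (intro conjI continuous_on_compose2[OF L] continuous_intros)
       (auto simp: closed_cut_plane_def)
next
  assume R: ?R
  have eq: "closed_cut_plane = {True} \<times> {z. 0 \<le> Im z} \<union> {False} \<times> {z. Im z \<le> 0}"
    by (auto simp: closed_cut_plane_def split: if_splits)
  have c: "closed ({True} \<times> {z. 0 \<le> Im z})" "closed ({False} \<times> {z. Im z \<le> 0})"
    by (intro closed_Times closed_singleton closed_halfspace_Im_ge closed_halfspace_Im_le)+
  have "continuous_on ({True} \<times> {z. 0 \<le> Im z}) (\<lambda>p. f (True, snd p))"
    by (rule continuous_on_compose2[OF conjunct1[OF R]]) (auto intro!: continuous_intros)
  hence 1: "continuous_on ({True} \<times> {z. 0 \<le> Im z}) f"
    by (rule continuous_on_eq) auto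
  have "continuous_on ({False} \<times> {z. Im z \<le> 0}) (\<lambda>p. f (False, snd p))"
    by (rule continuous_on_compose2[OF conjunct2[OF R]]) (auto intro!: continuous_intros)
  hence 2: "continuous_on ({False} \<times> {z. Im z \<le> 0}) f"
    by (rule continuous_on_eq) auto
  show ?L unfolding eq by (rule continuous_on_closed_Un[OF c 1 2])
qed

text \<open>The values \<open>\<plusminus>\<bar>t\<bar>\<^sup>1\<^sup>/\<^sup>2\<close> on the edges are the limits of the analytic branch.\<close>

lemma continuous_on_branch_sqrt_cut: "continuous_on closed_cut_plane branch_sqrt_cut"
  unfolding continuous_on_closed_cut_plane_iff
proof
  show "continuous_on {z. 0 \<le> Im z} (\<lambda>z. branch_sqrt_cut (True, z))"
    by (rule continuous_on_eq[OF continuous_on_csqrt_upper]) (simp add: branch_sqrt_cut_upper)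
  have "continuous_on {z. Im z \<le> 0} branch_sqrt"
    unfolding branch_sqrt_def
    by (intro continuous_intros continuous_on_compose2[OF continuous_on_csqrt_upper]) auto
  thus "continuous_on {z. Im z \<le> 0} (\<lambda>z. branch_sqrt_cut (False, z))"
    by (rule continuous_on_eq) (simp add: branch_sqrt_cut_lower)
qed


section \<open>The Jacobi difference equation and the Ansatz for its solutions\<close>

definition jacobi_solution ::
    "(nat \<Rightarrow> real) \<Rightarrow> (nat \<Rightarrow> real) \<Rightarrow> complex \<Rightarrow> (nat \<Rightarrow> complex) \<Rightarrow> bool" where
  "jacobi_solution a b z F \<longleftrightarrow>
     (\<forall>n\<ge>1. of_real (a (n - 1)) * F (n - 1) + of_real (b n) * F n + of_real (a n) * F (n + 1)
             = z * F n)"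

definition t_seq :: "real \<Rightarrow> real \<Rightarrow> nat \<Rightarrow> complex \<Rightarrow> complex" where
  "t_seq \<sigma> \<tau> n z = - of_real \<tau> / of_nat n + z * of_real (real n powr (- \<sigma>))"

definition theta :: "real \<Rightarrow> real \<Rightarrow> nat \<Rightarrow> complex \<Rightarrow> complex" where
  "theta \<sigma> \<tau> n z = branch_sqrt (t_seq \<sigma> \<tau> n z)"

text \<open>On the closed cut plane, \<open>t\<^sub>n(\<lambda> \<plusminus> i0) = t\<^sub>n(\<lambda>) \<plusminus> i0\<close>.\<close>

definition theta_cut :: "real \<Rightarrow> real \<Rightarrow> nat \<Rightarrow> bool \<times> complex \<Rightarrow> complex" where
  "theta_cut \<sigma> \<tau> n p = branch_sqrt_cut (fst p, t_seq \<sigma> \<tau> n (snd p))"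

definition ansatz :: "real \<Rightarrow> real \<Rightarrow> nat \<Rightarrow> complex \<Rightarrow> complex" where
  "ansatz \<gamma> \<rho> n \<phi> = of_real ((- \<gamma>) ^ n * real n powr (- \<rho>)) * exp (\<i> * \<phi>)"

text \<open>\<open>f\<^sub>n(p) = g\<^sub>n(p) (1 + o(1))\<close> as \<open>n \<rightarrow> \<infinity>\<close>, uniformly for \<open>p \<in> K\<close>\<close>

definition asymptotic_uniformly_on ::
    "'p set \<Rightarrow> (nat \<Rightarrow> 'p \<Rightarrow> complex) \<Rightarrow> (nat \<Rightarrow> 'p \<Rightarrow> complex) \<Rightarrow> bool" where
  "asymptotic_uniformly_on K f g \<longleftrightarrow>
     (\<exists>\<epsilon>. uniform_limit K \<epsilon> (\<lambda>_. 0) sequentially \<and>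
          (\<forall>\<^sub>F n in sequentially. \<forall>p\<in>K. f n p = g n p * (1 + \<epsilon> n p)))"

end

theory Submission
  imports Defs "HOL-Real_Asymp.Real_Asymp"
begin

text \<open>
  Up to the factor \<open>(- \<gamma>) ^ n\<close> the recurrence is a discretisation of \<open>G'' + (\<sigma> / n) G' + t\<^sub>n G = 0\<close>, and
  \<open>n powr (- \<rho>) * exp (\<i> * \<phi>\<^sub>n)\<close> is its WKB approximation.  Inserted into the recurrence, this
  Ansatz leaves a residual which is smaller than the leading terms by \<open>O(n powr (- \<sigma> - 1 / 2))\<close>
  (\<open>residual_bound\<close>): the terms of order \<open>n powr (- 3 / 2)\<close> cancel by the choice of \<open>\<rho>\<close>, those of
  order \<open>1 / n\<close> because \<open>\<theta>\<^sub>n\<^sup>2 = t\<^sub>n\<close>.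

  The quotient of a solution by the Ansatz then satisfies a Volterra equation.  Its kernel is the
  residual times the Ansatz times a sum of oscillating or growing exponentials; as
  \<open>\<bar>exp (- 2 * \<i> * \<phi>\<^sub>n)\<bar>\<close> is nondecreasing for large \<open>n\<close>, summation by parts bounds this sum by its last
  term, the exponentials cancel, and the kernel is \<open>O(m powr (- \<sigma>))\<close> (\<open>kernel_bound\<close>).  This is
  summable because \<open>\<sigma> > 1\<close>.

  The solution is not defined by an infinite Volterra equation, which would make sense only for
  large \<open>n\<close> depending on the spectral parameter, but as the limit for \<open>M \<rightarrow> \<infinity>\<close> of the solutions that
  coincide with the Ansatz at \<open>M\<close> and \<open>M + 1\<close> (\<open>truncated_solution_limit\<close>).  These are explicit for all
  \<open>n\<close> and all values of the parameter, converge locally uniformly by the finite Volterra equations,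
  and hand on analyticity and continuity from the Ansatz to the limit.

  For \<open>\<tau> < 0\<close> the Ansatz is used as it stands (\<open>solution_up_to_cut\<close>).  For \<open>\<tau> > 0\<close> it has branch points
  in the plane.  There \<open>\<theta>\<^sub>n\<close> is replaced by \<open>\<i> (\<tau> / n)\<^sup>1\<^sup>/\<^sup>2 q(\<gamma> z n powr (1 - \<sigma>) / \<tau>)\<close> with a polynomial
  \<open>q(x)\<close> that agrees with \<open>(1 - x)\<^sup>1\<^sup>/\<^sup>2\<close> to high order at \<open>0\<close>; all estimates persist, the solution becomes
  entire, and since the differences of the two phase increments are summable on each disc, the
  return to \<open>\<theta>\<^sub>n\<close> costs only an analytic factor \<open>C\<close> (\<open>entire_solution\<close>).
\<close>

section \<open>Solutions prescribed far out and the Volterra equation\<close>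

text \<open>
  The solution of the three-term recurrence that agrees with a given sequence \<open>A\<close> at \<open>M\<close> and
  \<open>M + 1\<close>, computed downwards.  Beyond \<open>M + 1\<close> it is simply continued by \<open>A\<close>, so that the
  quotient by \<open>A\<close> is \<open>1\<close> from \<open>M\<close> on.
\<close>

function truncated_solution ::
    "(nat \<Rightarrow> real) \<Rightarrow> (nat \<Rightarrow> real) \<Rightarrow> complex \<Rightarrow> (nat \<Rightarrow> complex) \<Rightarrow> nat \<Rightarrow> nat \<Rightarrow> complex" where
  "truncated_solution a b z A M n =
     (if M \<le> n then A n
      else ((z - of_real (b (Suc n))) * truncated_solution a b z A M (Suc n)
            - of_real (a (Suc n)) * truncated_solution a b z A M (Suc (Suc n))) / of_real (a n))"
  by pat_completeness auto
termination by (relation "Wellfounded.measure (\<lambda>(a, b, z, A, M, n). M - n)") auto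

declare truncated_solution.simps [simp del]

lemma truncated_solution_eq_anchor: "M \<le> n \<Longrightarrow> truncated_solution a b z A M n = A n"
  by (simp add: truncated_solution.simps)

lemma truncated_solution_recurrence:
  assumes "\<And>n. a n > 0" "1 \<le> n" "n \<le> M"
  shows "of_real (a (n - 1)) * truncated_solution a b z A M (n - 1)
     = (z - of_real (b n)) * truncated_solution a b z A M n
       - of_real (a n) * truncated_solution a b z A M (n + 1)"
  using assms(2,3) assms(1)[of "n - 1"]
  by (subst truncated_solution.simps) auto

text \<open>
  Variation of parameters from the point \<open>M\<close> downwards.  The Wronskian of \<open>A\<close> and the solution
  vanishes at \<open>M\<close>, and its decrements are the residuals of \<open>A\<close> times the solution; summing twice
  and exchanging the summations gives the kernel.
\<close>

lemma truncated_solution_volterra: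
  fixes a b :: "nat \<Rightarrow> real" and A :: "nat \<Rightarrow> complex" and z :: complex
  defines "res \<equiv> \<lambda>m. of_real (a (m - 1)) * A (m - 1) + (of_real (b m) - z) * A m
                       + of_real (a m) * A (m + 1)"
  assumes a: "\<And>n. a n > 0" and A: "\<And>n. n \<ge> 1 \<Longrightarrow> A n \<noteq> 0" and n: "1 \<le> n" "n \<le> M"
  shows "truncated_solution a b z A M n / A n
     = 1 - (\<Sum>m\<in>{n<..M}. res m * A m * (\<Sum>k\<in>{n..<m}. 1 / (of_real (a k) * A k * A (Suc k)))
                          * (truncated_solution a b z A M m / A m))"
proof -
  define T where "T = truncated_solution a b z A M"
  define c where "c = (\<lambda>k. 1 / (of_real (a k) * A k * A (Suc k)))"
  define w where "w = (\<lambda>k. of_real (a k) * (A k * T (Suc k) - A (Suc k) * T k))"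
  have w_step: "w (k - 1) = w k + res k * T k" if "1 \<le> k" "k \<le> M" for k
  proof -
    have r: "of_real (a (k - 1)) * T (k - 1) = (z - of_real (b k)) * T k - of_real (a k) * T (Suc k)"
      using truncated_solution_recurrence[of a, OF a that] by (simp add: T_def)
    have "w (k - 1) = of_real (a (k - 1)) * A (k - 1) * T k - A k * (of_real (a (k - 1)) * T (k - 1))"
      using that by (simp add: w_def algebra_simps)
    thus ?thesis unfolding r by (simp add: w_def res_def algebra_simps)
  qed
  have wM: "w M = 0"
    by (simp add: w_def T_def truncated_solution_eq_anchor)
  have ioc: "{k<..M} = insert (Suc k) {Suc k<..M}" if "k < M" for k
    using that by auto
  have w_sum: "w k = (\<Sum>m\<in>{k<..M}. res m * T m)" if "k \<le> M" for k
    using that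
  proof (induction rule: inc_induct)
    case (step k)
    thus ?case using w_step[of "Suc k"] ioc[of k] by simp
  qed (simp add: wM)
  have "T n / A n = 1 - (\<Sum>m\<in>{n<..M}. res m * T m * (\<Sum>k\<in>{n..<m}. c k))"
    using n(2,1)
  proof (induction rule: inc_induct)
    case base
    thus ?case using A by (simp add: T_def truncated_solution_eq_anchor)
  next
    case (step n)
    have "T (Suc n) / A (Suc n) - T n / A n = w n * c n"
      using A[of n] A[of "Suc n"] step.prems a[of n] by (simp add: w_def c_def field_simps)
    moreover have "(\<Sum>m\<in>{n<..M}. res m * T m * (\<Sum>k\<in>{n..<m}. c k))
        = (\<Sum>m\<in>{n<..M}. res m * T m * c n + res m * T m * (\<Sum>k\<in>{Suc n..<m}. c k))"
      by (intro sum.cong refl) (auto simp: sum.atLeast_Suc_lessThan distrib_left)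
    moreover have "\<dots> = w n * c n + (\<Sum>m\<in>{n<..M}. res m * T m * (\<Sum>k\<in>{Suc n..<m}. c k))"
      using step.hyps w_sum[of n] by (simp add: sum.distrib sum_distrib_right)
    moreover have "(\<Sum>m\<in>{n<..M}. res m * T m * (\<Sum>k\<in>{Suc n..<m}. c k))
        = (\<Sum>m\<in>{Suc n<..M}. res m * T m * (\<Sum>k\<in>{Suc n..<m}. c k))"
      using step.hyps by (subst ioc) auto
    ultimately show ?case using step by (simp add: algebra_simps)
  qed
  also have "(\<Sum>m\<in>{n<..M}. res m * T m * (\<Sum>k\<in>{n..<m}. c k))
      = (\<Sum>m\<in>{n<..M}. res m * A m * (\<Sum>k\<in>{n..<m}. c k) * (T m / A m))"
    using A n by (intro sum.cong refl) auto
  finally show ?thesis unfolding T_def c_def .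
qed

lemma summable_tail_bound:
  fixes g :: "nat \<Rightarrow> real"
  assumes "summable g" "\<And>m. g m \<ge> 0"
  obtains G where "G \<longlonglongrightarrow> 0" "\<And>n M. sum g {n<..M} \<le> G n"
proof
  let ?G = "\<lambda>n. suminf g - sum g {..n}"
  have "(\<lambda>n. sum g {..n}) \<longlonglongrightarrow> suminf g"
    using assms(1) summable_LIMSEQ' by blast
  thus "?G \<longlonglongrightarrow> 0" by (auto intro!: tendsto_eq_intros)
  fix n M
  show "sum g {n<..M} \<le> ?G n"
  proof (cases "n \<le> M")
    case True
    have "sum g {..M} = sum g {..n} + sum g {n<..M}"
      using True by (subst sum.union_disjoint[symmetric]) (auto intro!: sum.cong)
    moreover have "sum g {..M} \<le> suminf g" using assms by (intro sum_le_suminf) auto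
    ultimately show ?thesis by linarith
  qed (use assms in \<open>auto intro!: sum_le_suminf\<close>)
qed

text \<open>
  Gronwall's inequality run downwards; the smallness of the tail makes the constant explicit and
  independent of \<open>M\<close>.
\<close>

lemma backward_gronwall:
  fixes g x :: "nat \<Rightarrow> real"
  assumes "\<And>n. N \<le> n \<Longrightarrow> sum g {n<..M} \<le> 1 / 2" "\<And>m. g m \<ge> 0" "\<delta> \<ge> 0"
    and "\<And>n. N \<le> n \<Longrightarrow> n \<le> M \<Longrightarrow> x n \<le> \<delta> + (\<Sum>m\<in>{n<..M}. g m * x m)"
    and "N \<le> n" "n \<le> M"
  shows "x n \<le> 2 * \<delta>"
  using assms(5,6)
proof (induction "M - n" arbitrary: n rule: less_induct)
  case less
  have "(\<Sum>m\<in>{n<..M}. g m * x m) \<le> (\<Sum>m\<in>{n<..M}. g m * (2 * \<delta>))"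
    using less assms(2) by (intro sum_mono mult_left_mono) auto
  also have "\<dots> = sum g {n<..M} * (2 * \<delta>)" by (simp add: sum_distrib_right)
  also have "\<dots> \<le> 1 / 2 * (2 * \<delta>)" using assms(1)[of n] assms(3) less.prems
    by (intro mult_right_mono) auto
  finally show ?case using assms(4)[of n] less.prems by simp
qed

text \<open>
  Gronwall's inequality twice: for the solution with datum \<open>1\<close>, and for the difference of the solutions
  truncated at \<open>M\<close> and \<open>M'\<close>, whose datum is the part of the sum beyond \<open>M\<close>.
\<close>

lemma truncated_volterra_estimates:
  fixes u :: "nat \<Rightarrow> nat \<Rightarrow> complex" and \<kappa> :: "nat \<Rightarrow> nat \<Rightarrow> complex" and g :: "nat \<Rightarrow> real"
  assumes g: "\<And>m. g m \<ge> 0" and G: "\<And>n M. sum g {n<..M} \<le> G n" "\<And>n. N \<le> n \<Longrightarrow> G n \<le> 1 / 2"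
    and u: "\<And>M n. N \<le> n \<Longrightarrow> n \<le> M \<Longrightarrow> u M n = 1 - (\<Sum>m\<in>{n<..M}. \<kappa> n m * u M m)"
    and \<kappa>: "\<And>n m. N \<le> n \<Longrightarrow> n < m \<Longrightarrow> norm (\<kappa> n m) \<le> g m"
    and n: "N \<le> n" "n \<le> M"
  shows "norm (u M n - 1) \<le> 2 * G n"
    and "M \<le> M' \<Longrightarrow> norm (u M' n - u M n) \<le> 4 * G M"
proof -
  have small: "sum g {n<..M} \<le> 1 / 2" if "N \<le> n" for n M
    using G(1)[of n M] G(2)[OF that] by linarith
  have dom: "norm (\<Sum>m\<in>S. \<kappa> n m * v m) \<le> (\<Sum>m\<in>S. g m * norm (v m))"
    if "N \<le> n" "S \<subseteq> {n<..}" for n S and v :: "nat \<Rightarrow> complex"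
    using that \<kappa> by (intro order.trans[OF norm_sum] sum_mono) (auto simp: norm_mult intro!: mult_right_mono)
  have sub: "{n<..M} \<subseteq> {n<..}" for n M :: nat by auto
  have bd: "norm (u M n) \<le> 2" if "N \<le> n" "n \<le> M" for M n
  proof -
    have "norm (u M n) \<le> 2 * 1"
    proof (rule backward_gronwall[where g = g and x = "\<lambda>n. norm (u M n)", OF small g _ _ that])
      fix n assume n: "N \<le> n" "n \<le> M"
      have "norm (u M n) \<le> norm (1::complex) + norm (\<Sum>m\<in>{n<..M}. \<kappa> n m * u M m)"
        unfolding u[OF n] by (rule norm_triangle_ineq4)
      thus "norm (u M n) \<le> 1 + (\<Sum>m\<in>{n<..M}. g m * norm (u M m))"
        using dom[OF n(1) sub, of "u M" M] by simp
    qed auto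
    thus ?thesis by simp
  qed
  have tail: "(\<Sum>m\<in>S. g m * norm (u M m)) \<le> 2 * G k" if "S \<subseteq> {k<..M}" "N \<le> k" for S M k
  proof -
    have fin: "finite S" using that(1) finite_subset by blast
    have "(\<Sum>m\<in>S. g m * norm (u M m)) \<le> (\<Sum>m\<in>S. g m * 2)"
      using that bd g by (intro sum_mono mult_left_mono) force+
    also have "\<dots> = 2 * sum g S" by (simp flip: sum_distrib_right)
    also have "\<dots> \<le> 2 * sum g {k<..M}" using that g by (intro mult_left_mono sum_mono2) auto
    finally show ?thesis using G(1)[of k M] by linarith
  qed
  have "norm (u M n - 1) = norm (\<Sum>m\<in>{n<..M}. \<kappa> n m * u M m)"
    unfolding u[OF n] by (simp add: norm_minus_commute)
  also have "\<dots> \<le> 2 * G n"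
    using dom[OF n(1), of "{n<..M}" "u M"] tail[of "{n<..M}" n M] n by fastforce
  finally show "norm (u M n - 1) \<le> 2 * G n" .
  assume M': "M \<le> M'"
  have GM: "0 \<le> G M" using G(1)[of M M] by simp
  have "norm (u M' n - u M n) \<le> 2 * (2 * G M)"
  proof (rule backward_gronwall[where g = g and x = "\<lambda>n. norm (u M' n - u M n)", OF small g _ _ n])
    fix n assume n: "N \<le> n" "n \<le> M"
    have "{n<..M'} = {n<..M} \<union> {M<..M'}" using n M' by auto
    hence "(\<Sum>m\<in>{n<..M'}. \<kappa> n m * u M' m) =
        (\<Sum>m\<in>{n<..M}. \<kappa> n m * u M' m) + (\<Sum>m\<in>{M<..M'}. \<kappa> n m * u M' m)"
      by (simp add: sum.union_disjoint)
    hence "u M' n - u M n = - (\<Sum>m\<in>{n<..M}. \<kappa> n m * (u M' m - u M m)) - (\<Sum>m\<in>{M<..M'}. \<kappa> n m * u M' m)"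
      using u[OF n] u[of n M'] n M' by (simp add: sum_subtractf algebra_simps)
    hence "norm (u M' n - u M n) \<le> norm (\<Sum>m\<in>{n<..M}. \<kappa> n m * (u M' m - u M m))
        + norm (\<Sum>m\<in>{M<..M'}. \<kappa> n m * u M' m)"
      by (metis norm_minus_cancel norm_triangle_ineq4)
    also have "\<dots> \<le> (\<Sum>m\<in>{n<..M}. g m * norm (u M' m - u M m)) + 2 * G M"
      using dom[of n "{n<..M}" "\<lambda>m. u M' m - u M m"] dom[of n "{M<..M'}" "u M'"]
        tail[of "{M<..M'}" M M'] n by force
    finally show "norm (u M' n - u M n) \<le> 2 * G M + (\<Sum>m\<in>{n<..M}. g m * norm (u M' m - u M m))"
      by simp
  qed (use GM in auto)
  thus "norm (u M' n - u M n) \<le> 4 * G M" by simp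
qed

lemma uniformly_convergent_on_mult_bounded:
  fixes g :: "nat \<Rightarrow> 'p \<Rightarrow> complex"
  assumes "uniformly_convergent_on K g" and B: "\<And>p. p \<in> K \<Longrightarrow> norm (h p) \<le> B"
  shows "uniformly_convergent_on K (\<lambda>M p. h p * g M p)"
proof (rule Cauchy_uniformly_convergent, rule uniformly_Cauchy_onI)
  fix e :: real assume e: "e > 0"
  define B' where "B' = max B 1"
  have B': "B' > 0" "\<And>p. p \<in> K \<Longrightarrow> norm (h p) \<le> B'" using B by (auto simp: B'_def le_max_iff_disj)
  have "uniformly_Cauchy_on K g" using assms(1) uniformly_convergent_Cauchy by blast
  then obtain M0 where M0: "\<And>p m n. p \<in> K \<Longrightarrow> m \<ge> M0 \<Longrightarrow> n \<ge> M0 \<Longrightarrow> dist (g m p) (g n p) < e / B'"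
    unfolding uniformly_Cauchy_on_def using e B' by (metis divide_pos_pos)
  have "dist (h p * g m p) (h p * g n p) < e" if "p \<in> K" "m \<ge> M0" "n \<ge> M0" for p m n
  proof -
    have "dist (h p * g m p) (h p * g n p) = norm (h p) * dist (g m p) (g n p)"
      by (simp add: dist_norm norm_mult flip: right_diff_distrib)
    also have "\<dots> \<le> B' * dist (g m p) (g n p)" using B'(2) that by (intro mult_right_mono) auto
    also have "\<dots> < B' * (e / B')" using M0 that B' by (intro mult_strict_left_mono) auto
    finally show ?thesis using B' by simp
  qed
  thus "\<exists>M. \<forall>x\<in>K. \<forall>m\<ge>M. \<forall>n\<ge>M. dist (h x * g m x) (h x * g n x) < e" by blast
qed

text \<open>
  The limit of the truncated solutions.  The lemma is stated for a family depending on a parameter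
  \<open>p\<close> without any structure: because the solutions are limits of explicit expressions, continuity
  and analyticity in \<open>p\<close> can be read off afterwards, and no choice of a solution enters.
\<close>

lemma truncated_solution_limit:
  fixes a b :: "nat \<Rightarrow> real" and A :: "nat \<Rightarrow> 'p \<Rightarrow> complex" and \<zeta> :: "'p \<Rightarrow> complex" and K :: "'p set"
  defines "T \<equiv> \<lambda>n M p. truncated_solution a b (\<zeta> p) (\<lambda>n. A n p) M n"
    and "res \<equiv> \<lambda>m p. of_real (a (m - 1)) * A (m - 1) p + (of_real (b m) - \<zeta> p) * A m p
                       + of_real (a m) * A (m + 1) p"
  assumes a: "\<And>n. a n > 0" and A: "\<And>n p. n \<ge> 1 \<Longrightarrow> A n p \<noteq> 0"
    and A_bd: "\<And>n. \<exists>B. \<forall>p\<in>K. norm (A n p) \<le> B" and \<zeta>_bd: "\<And>p. p \<in> K \<Longrightarrow> norm (\<zeta> p) \<le> R"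
    and g: "summable g" "\<And>m. g m \<ge> 0"
    and kernel: "\<And>n m p. N0 \<le> n \<Longrightarrow> n < m \<Longrightarrow> p \<in> K \<Longrightarrow>
      norm (res m p * A m p * (\<Sum>k\<in>{n..<m}. 1 / (of_real (a k) * A k p * A (Suc k) p))) \<le> g m"
  shows "uniformly_convergent_on K (T n)"
    and "p \<in> K \<Longrightarrow> jacobi_solution a b (\<zeta> p) (\<lambda>n. lim (\<lambda>M. T n M p))"
    and "asymptotic_uniformly_on K (\<lambda>n p. lim (\<lambda>M. T n M p)) A"
proof -
  obtain G where G: "G \<longlonglongrightarrow> 0" "\<And>n M. sum g {n<..M} \<le> G n"
    using summable_tail_bound[OF g] by blast
  have "\<forall>\<^sub>F n in sequentially. G n < 1 / 2" using G(1) by (rule order_tendstoD) simp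
  then obtain N1 where N1: "\<And>n. n \<ge> N1 \<Longrightarrow> G n < 1 / 2" by (auto simp: eventually_sequentially)
  \<comment> \<open>\<open>A 0\<close> may vanish, and the kernel is controlled far out only; the other values follow by the recurrence.\<close>
  define N where "N = Max {N0, N1, 1}"
  have N: "N0 \<le> N" "N1 \<le> N" "1 \<le> N" by (auto simp: N_def)
  define u where "u = (\<lambda>p M n. T n M p / A n p)"
  define \<kappa> where "\<kappa> = (\<lambda>p n m. res m p * A m p *
    (\<Sum>k\<in>{n..<m}. 1 / (of_real (a k) * A k p * A (Suc k) p)))"
  have volterra: "u p M n = 1 - (\<Sum>m\<in>{n<..M}. \<kappa> p n m * u p M m)" if "N \<le> n" "n \<le> M" for p M n
    unfolding u_def T_def \<kappa>_def res_def
    by (rule truncated_solution_volterra[OF a A]) (use that N in auto)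
  have ker: "norm (\<kappa> p n m) \<le> g m" if "N \<le> n" "n < m" "p \<in> K" for p n m
    unfolding \<kappa>_def using that N by (intro kernel) auto
  have u1: "norm (u p M n - 1) \<le> 2 * G n" if "p \<in> K" "N \<le> n" "n \<le> M" for p M n
    using that N N1
    by (intro truncated_volterra_estimates(1)[where N = N and g = g and \<kappa> = "\<kappa> p", OF g(2) G(2) _ volterra ker])
       (auto intro: less_imp_le)
  have u2: "norm (u p M' n - u p M n) \<le> 4 * G M" if "p \<in> K" "N \<le> n" "n \<le> M" "M \<le> M'" for p M n M'
    using that N N1
    by (intro truncated_volterra_estimates(2)[where N = N and g = g and \<kappa> = "\<kappa> p", OF g(2) G(2) _ volterra ker])
       (auto intro: less_imp_le)
  have T_u: "T n M p = A n p * u p M n" if "N \<le> n" for n M p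
    using A[of n p] that N by (simp add: u_def)
  have u_conv: "uniformly_convergent_on K (\<lambda>M p. u p M n)" if n: "N \<le> n" for n
  proof (rule Cauchy_uniformly_convergent, rule uniformly_Cauchy_onI')
    fix e :: real assume "e > 0"
    hence "\<forall>\<^sub>F M in sequentially. G M < e / 4" using G(1) by (intro order_tendstoD) auto
    then obtain M0 where M0: "\<And>M. M \<ge> M0 \<Longrightarrow> G M < e / 4" by (auto simp: eventually_sequentially)
    have "dist (u p M n) (u p M' n) < e" if "p \<in> K" "M \<ge> max M0 n" "M' > M" for p M M'
      using u2[of p n M M'] M0[of M] that n by (simp add: dist_norm norm_minus_commute)
    thus "\<exists>M. \<forall>p\<in>K. \<forall>m\<ge>M. \<forall>k>m. dist (u p m n) (u p k n) < e" by blast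
  qed
  have large: "uniformly_convergent_on K (T n)" if "N \<le> n" for n
  proof -
    obtain B where "\<forall>p\<in>K. norm (A n p) \<le> B" using A_bd by blast
    hence "uniformly_convergent_on K (\<lambda>M p. A n p * u p M n)"
      using u_conv[OF that] by (intro uniformly_convergent_on_mult_bounded) auto
    moreover have "T n = (\<lambda>M p. A n p * u p M n)" using T_u[OF that] by (simp add: fun_eq_iff)
    ultimately show ?thesis by simp
  qed
  have "uniformly_convergent_on K (T n) \<and> uniformly_convergent_on K (T (Suc n))" for n
  proof (cases "n \<le> N")
    case True
    thus ?thesis
    proof (induction rule: inc_induct)
      case (step n)
      define h where "h = (\<lambda>p. (\<zeta> p - of_real (b (Suc n))) / of_real (a n))"
      define h' :: "'p \<Rightarrow> complex" where "h' = (\<lambda>p. - (of_real (a (Suc n)) / of_real (a n)))"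
      have 1: "norm (h p) \<le> (R + \<bar>b (Suc n)\<bar>) / a n" if "p \<in> K" for p
      proof -
        have "norm (\<zeta> p - of_real (b (Suc n))) \<le> R + \<bar>b (Suc n)\<bar>"
          using norm_triangle_ineq4[of "\<zeta> p" "of_real (b (Suc n))"] \<zeta>_bd[OF that] by simp
        thus ?thesis using a[of n] by (simp add: h_def norm_divide divide_right_mono)
      qed
      have "uniformly_convergent_on K (\<lambda>M p. h p * T (Suc n) M p + h' p * T (Suc (Suc n)) M p)"
        using step.IH 1
        by (intro uniformly_convergent_add uniformly_convergent_on_mult_bounded) (auto simp: h'_def)
      moreover have "h p * T (Suc n) M p + h' p * T (Suc (Suc n)) M p = T n M p" if "M \<ge> Suc n" for M p
        using that unfolding T_def h_def h'_def by (subst (3) truncated_solution.simps) (simp add: diff_divide_distrib left_diff_distrib)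
      ultimately have "uniformly_convergent_on K (T n)"
        by (subst uniformly_convergent_cong[where g = "\<lambda>M p. h p * T (Suc n) M p + h' p * T (Suc (Suc n)) M p" and B = K])
           (auto simp: eventually_sequentially intro!: exI[of _ "Suc n"])
      thus ?case using step.IH by blast
    qed (use large[of N] large[of "Suc N"] in simp)
  qed (use large[of n] large[of "Suc n"] in simp)
  thus conv: "uniformly_convergent_on K (T n)" for n by blast
  have lims: "(\<lambda>M. T n M p) \<longlonglongrightarrow> lim (\<lambda>M. T n M p)" if "p \<in> K" for n p
    using conv[of n] that tendsto_uniform_limitI uniformly_convergent_uniform_limit_iff by fast
  show "jacobi_solution a b (\<zeta> p) (\<lambda>n. lim (\<lambda>M. T n M p))" if p: "p \<in> K"
    unfolding jacobi_solution_def
  proof safe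
    fix n :: nat assume n: "n \<ge> 1"
    let ?f = "\<lambda>n. lim (\<lambda>M. T n M p)"
    have l1: "(\<lambda>M. of_real (a (n - 1)) * T (n - 1) M p + of_real (b n) * T n M p + of_real (a n) * T (n + 1) M p)
       \<longlonglongrightarrow> of_real (a (n - 1)) * ?f (n - 1) + of_real (b n) * ?f n + of_real (a n) * ?f (n + 1)"
      by (intro tendsto_intros lims p)
    have "of_real (a (n - 1)) * T (n - 1) M p + of_real (b n) * T n M p + of_real (a n) * T (n + 1) M p
        = \<zeta> p * T n M p" if "M \<ge> n" for M
      using truncated_solution_recurrence[of a n M b "\<zeta> p" "\<lambda>n. A n p", OF a n that]
      by (simp add: T_def algebra_simps)
    hence "\<forall>\<^sub>F M in sequentially. of_real (a (n - 1)) * T (n - 1) M p + of_real (b n) * T n M p + of_real (a n) * T (n + 1) M p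
        = \<zeta> p * T n M p"
      by (auto simp: eventually_sequentially)
    from Lim_transform_eventually[OF l1 this]
    show "of_real (a (n - 1)) * ?f (n - 1) + of_real (b n) * ?f n + of_real (a n) * ?f (n + 1) = \<zeta> p * ?f n"
      by (rule LIMSEQ_unique) (intro tendsto_intros lims p)
  qed
  define \<epsilon> where "\<epsilon> = (\<lambda>n p. lim (\<lambda>M. T n M p) / A n p - 1)"
  have \<epsilon>: "norm (\<epsilon> n p) \<le> 2 * G n" if "p \<in> K" "N \<le> n" for n p
  proof -
    have "(\<lambda>M. norm (T n M p / A n p - 1)) \<longlonglongrightarrow> norm (\<epsilon> n p)"
      unfolding \<epsilon>_def using A[of n p] that N by (intro tendsto_intros lims) auto
    moreover have "\<forall>\<^sub>F M in sequentially. norm (T n M p / A n p - 1) \<le> 2 * G n"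
      using u1[OF that] by (auto simp: u_def eventually_sequentially)
    ultimately show ?thesis by (intro tendsto_upperbound) auto
  qed
  have "uniform_limit K \<epsilon> (\<lambda>_. 0) sequentially"
  proof (rule uniform_limitI)
    fix e :: real assume "e > 0"
    hence "\<forall>\<^sub>F n in sequentially. G n < e / 2" using G(1) by (intro order_tendstoD) auto
    moreover have "\<forall>\<^sub>F n in sequentially. N \<le> n" by (rule eventually_ge_at_top)
    ultimately show "\<forall>\<^sub>F n in sequentially. \<forall>p\<in>K. dist (\<epsilon> n p) 0 < e"
      by eventually_elim (use \<epsilon> in fastforce)
  qed
  moreover have "\<forall>\<^sub>F n in sequentially. \<forall>p\<in>K. lim (\<lambda>M. T n M p) = A n p * (1 + \<epsilon> n p)"
    using A by (auto simp: eventually_sequentially \<epsilon>_def intro!: exI[of _ 1])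
  ultimately show "asymptotic_uniformly_on K (\<lambda>n p. lim (\<lambda>M. T n M p)) A"
    unfolding asymptotic_uniformly_on_def by blast
qed

section \<open>Uniform power bounds\<close>

text \<open>
  A bound by a fixed power instead of a Landau symbol: the exponents add under multiplication, so that
  orders of smallness, uniform in \<open>p\<close>, can be tracked by linear arithmetic.
\<close>

definition uniform_bigo :: "'p set \<Rightarrow> real \<Rightarrow> (nat \<Rightarrow> 'p \<Rightarrow> complex) \<Rightarrow> bool" where
  "uniform_bigo K e f \<longleftrightarrow>
     (\<exists>C. \<forall>\<^sub>F n in sequentially. \<forall>p\<in>K. norm (f n p) \<le> C * real n powr (- e))"

lemma uniform_bigoE:
  assumes "uniform_bigo K e f"
  obtains C N where "C > 0" "N \<ge> 1"
    "\<And>n p. n \<ge> N \<Longrightarrow> p \<in> K \<Longrightarrow> norm (f n p) \<le> C * real n powr (- e)"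
proof -
  obtain C N where C: "\<And>n p. n \<ge> N \<Longrightarrow> p \<in> K \<Longrightarrow> norm (f n p) \<le> C * real n powr (- e)"
    using assms by (auto simp: uniform_bigo_def eventually_sequentially)
  define C' where "C' = max C 1"
  have C': "C \<le> C'" "C' > 0" by (auto simp: C'_def)
  show thesis
  proof (rule that[of C' "max N 1"])
    fix n p assume np: "max N 1 \<le> n" "p \<in> K"
    have "C * real n powr (- e) \<le> C' * real n powr (- e)"
      using C' by (intro mult_right_mono) auto
    moreover have "norm (f n p) \<le> C * real n powr (- e)" using C[of n p] np by simp
    ultimately show "norm (f n p) \<le> C' * real n powr (- e)" by linarith
  qed (use C' in auto)
qed

lemma uniform_bigoI:
  "(\<And>n p. n \<ge> N \<Longrightarrow> p \<in> K \<Longrightarrow> norm (f n p) \<le> C * real n powr (- e)) \<Longrightarrow> uniform_bigo K e f"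
  unfolding uniform_bigo_def eventually_sequentially by blast

lemma uniform_bigo_cong:
  assumes "uniform_bigo K e f" "\<And>n p. n \<ge> N \<Longrightarrow> p \<in> K \<Longrightarrow> g n p = f n p"
  shows "uniform_bigo K e g"
proof -
  obtain C N' where C: "\<And>n p. n \<ge> N' \<Longrightarrow> p \<in> K \<Longrightarrow> norm (f n p) \<le> C * real n powr (- e)"
    by (rule uniform_bigoE[OF assms(1)]) blast
  show ?thesis using C assms(2) by (intro uniform_bigoI[of "max N N'" _ _ C]) auto
qed

lemma uniform_bigo_mono:
  assumes "uniform_bigo K e f" "e' \<le> e"
  shows "uniform_bigo K e' f"
  using assms(1)
proof (rule uniform_bigoE)
  fix C N assume C: "C > 0" "N \<ge> 1" "\<And>n p. n \<ge> N \<Longrightarrow> p \<in> K \<Longrightarrow> norm (f n p) \<le> C * real n powr (- e)"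
  have "C * real n powr (- e) \<le> C * real n powr (- e')" if "n \<ge> N" for n
    using C that assms(2) by (intro mult_left_mono powr_mono) auto
  thus ?thesis using C(3) by (intro uniform_bigoI[of N _ _ C]) (meson order.trans)
qed

lemma uniform_bigo_add:
  assumes "uniform_bigo K e f" "uniform_bigo K e g"
  shows "uniform_bigo K e (\<lambda>n p. f n p + g n p)"
  using assms(1)
proof (rule uniform_bigoE)
  fix C N assume f: "\<And>n p. n \<ge> N \<Longrightarrow> p \<in> K \<Longrightarrow> norm (f n p) \<le> C * real n powr (- e)"
  show ?thesis using assms(2)
  proof (rule uniform_bigoE)
    fix C' N' assume g: "\<And>n p. n \<ge> N' \<Longrightarrow> p \<in> K \<Longrightarrow> norm (g n p) \<le> C' * real n powr (- e)"
    show ?thesis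
    proof (rule uniform_bigoI[of "max N N'" _ _ "C + C'"])
      fix n p assume "max N N' \<le> n" "p \<in> K"
      thus "norm (f n p + g n p) \<le> (C + C') * real n powr (- e)"
        using f[of n p] g[of n p] norm_triangle_ineq[of "f n p" "g n p"] by (simp add: distrib_right)
    qed
  qed
qed

lemma uniform_bigo_mult:
  assumes "uniform_bigo K e f" "uniform_bigo K e' g" "e'' = e + e'"
  shows "uniform_bigo K e'' (\<lambda>n p. f n p * g n p)"
  using assms(1)
proof (rule uniform_bigoE)
  fix C N assume f: "C > 0" "\<And>n p. n \<ge> N \<Longrightarrow> p \<in> K \<Longrightarrow> norm (f n p) \<le> C * real n powr (- e)"
  show ?thesis using assms(2)
  proof (rule uniform_bigoE)
    fix C' N' assume g: "\<And>n p. n \<ge> N' \<Longrightarrow> p \<in> K \<Longrightarrow> norm (g n p) \<le> C' * real n powr (- e')"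
    show ?thesis
    proof (rule uniform_bigoI[of "max N N'" _ _ "C * C'"])
      fix n p assume "max N N' \<le> n" "p \<in> K"
      hence "norm (f n p * g n p) \<le> (C * real n powr (- e)) * (C' * real n powr (- e'))"
        unfolding norm_mult using f(1) by (intro mult_mono f(2) g) auto
      also have "\<dots> = C * C' * real n powr (- e'')"
        unfolding assms(3) minus_add_distrib powr_add by (simp only: mult_ac)
      finally show "norm (f n p * g n p) \<le> C * C' * real n powr (- e'')" .
    qed
  qed
qed

lemma uniform_bigo_const: "uniform_bigo K 0 (\<lambda>n p. c)"
  by (rule uniform_bigoI[of 1 _ _ "norm c"]) auto

lemma uniform_bigo_bounded:
  "(\<And>p. p \<in> K \<Longrightarrow> norm (h p) \<le> B) \<Longrightarrow> uniform_bigo K 0 (\<lambda>n. h)"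
  by (rule uniform_bigoI[of 1 _ _ B]) auto

lemma uniform_bigo_cmult:
  "uniform_bigo K e f \<Longrightarrow> uniform_bigo K e (\<lambda>n p. c * f n p)"
  using uniform_bigo_mult[OF uniform_bigo_const[of K c], of e f e] by simp

lemma uniform_bigo_diff:
  "uniform_bigo K e f \<Longrightarrow> uniform_bigo K e g \<Longrightarrow> uniform_bigo K e (\<lambda>n p. f n p - g n p)"
  using uniform_bigo_add[of K e f "\<lambda>n p. - 1 * g n p"] uniform_bigo_cmult[of K e g "- 1"] by simp

lemma uniform_bigo_power:
  assumes "uniform_bigo K e f" "e' = real k * e"
  shows "uniform_bigo K e' (\<lambda>n p. f n p ^ k)"
  unfolding assms(2)
proof (induction k)
  case (Suc k)
  have "uniform_bigo K (e + real k * e) (\<lambda>n p. f n p * f n p ^ k)"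
    by (rule uniform_bigo_mult[OF assms(1) Suc refl])
  thus ?case by (simp add: algebra_simps)
qed (simp add: uniform_bigo_const)

lemma uniform_bigo_of_real:
  assumes "f \<in> O(\<lambda>n. real n powr (- e))"
  shows "uniform_bigo K e (\<lambda>n p. of_real (f n))"
proof -
  obtain C where "\<forall>\<^sub>F n in sequentially. norm (f n) \<le> C * norm (real n powr (- e))"
    using landau_o.bigE[OF assms] by blast
  thus ?thesis unfolding uniform_bigo_def by (intro exI[of _ C]) (auto elim: eventually_mono)
qed

lemma uniform_bigo_Suc:
  assumes "uniform_bigo K e f" "e \<ge> 0"
  shows "uniform_bigo K e (\<lambda>n. f (Suc n))"
  using assms(1)
proof (rule uniform_bigoE)
  fix C N assume C: "C > 0" "N \<ge> 1" "\<And>n p. n \<ge> N \<Longrightarrow> p \<in> K \<Longrightarrow> norm (f n p) \<le> C * real n powr (- e)"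
  have "C * real (Suc n) powr (- e) \<le> C * real n powr (- e)" if "n \<ge> N" for n
    using C that assms(2) by (intro mult_left_mono powr_mono2') auto
  thus ?thesis using C(3) by (intro uniform_bigoI[of N _ _ C]) (meson le_SucI order.trans)
qed

lemma uniform_bigo_eventually_small:
  assumes "uniform_bigo K e f" "e > 0" "\<delta> > 0"
  shows "\<forall>\<^sub>F n in sequentially. \<forall>p\<in>K. norm (f n p) < \<delta>"
  using assms(1)
proof (rule uniform_bigoE)
  fix C N assume C: "\<And>n p. n \<ge> N \<Longrightarrow> p \<in> K \<Longrightarrow> norm (f n p) \<le> C * real n powr (- e)"
  have "(\<lambda>n. C * real n powr (- e)) \<longlonglongrightarrow> 0" using assms(2) by real_asymp
  hence "\<forall>\<^sub>F n in sequentially. C * real n powr (- e) < \<delta>" using assms(3) by (rule order_tendstoD)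
  moreover have "\<forall>\<^sub>F n in sequentially. n \<ge> N" by (rule eventually_ge_at_top)
  ultimately show ?thesis by eventually_elim (use C in fastforce)
qed

lemma uniform_bigo_exp_Taylor:
  assumes f: "uniform_bigo K e f" "e \<ge> 0" "e' = 4 * e"
  shows "uniform_bigo K e' (\<lambda>n p. exp (f n p) - (1 + f n p + f n p ^ 2 / 2 + f n p ^ 3 / 6))"
    and "uniform_bigo K 0 (\<lambda>n p. exp (f n p))"
proof -
  obtain C N where C: "C > 0" "N \<ge> 1" "\<And>n p. n \<ge> N \<Longrightarrow> p \<in> K \<Longrightarrow> norm (f n p) \<le> C * real n powr (- e)"
    by (rule uniform_bigoE[OF f(1)]) blast
  have le_C: "norm (f n p) \<le> C" if "n \<ge> N" "p \<in> K" for n p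
  proof -
    have "real n powr (- e) \<le> real n powr 0" using that C f(2) by (intro powr_mono) auto
    hence "real n powr (- e) \<le> 1" using that C(2) by simp
    hence "C * real n powr (- e) \<le> C * 1" using C(1) by (intro mult_left_mono) auto
    thus ?thesis using C(3)[OF that] by linarith
  qed
  show "uniform_bigo K 0 (\<lambda>n p. exp (f n p))"
  proof (rule uniform_bigoI[of N _ _ "exp C"])
    fix n p assume np: "n \<ge> N" "p \<in> K"
    have "norm (exp (f n p)) \<le> exp (norm (f n p))" by (rule norm_exp)
    also have "\<dots> \<le> exp C" using le_C[OF np] by simp
    finally show "norm (exp (f n p)) \<le> exp C * real n powr - 0" using C(2) np by simp
  qed
  show "uniform_bigo K e' (\<lambda>n p. exp (f n p) - (1 + f n p + f n p ^ 2 / 2 + f n p ^ 3 / 6))"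
  proof (rule uniform_bigoI[of N _ _ "exp C * C ^ 4"])
    fix n p assume np: "n \<ge> N" "p \<in> K"
    have "norm (exp (f n p) - (\<Sum>i\<le>3. f n p ^ i / fact i)) \<le> exp (norm (f n p)) * norm (f n p) ^ Suc 3 / fact 3"
      by (rule Taylor_exp_field)
    also have "(\<Sum>i\<le>3. f n p ^ i / fact i) = 1 + f n p + f n p ^ 2 / 2 + f n p ^ 3 / 6"
      by (simp add: numeral_3_eq_3 numeral_2_eq_2)
    also have "exp (norm (f n p)) * norm (f n p) ^ Suc 3 / fact 3 \<le> exp (norm (f n p)) * norm (f n p) ^ 4"
      using mult_nonneg_nonneg[OF exp_ge_zero[of "norm (f n p)"] zero_le_power[OF norm_ge_zero, of "f n p" 4]]
      by (simp add: fact_numeral eval_nat_numeral)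
    also have "\<dots> \<le> exp C * (C * real n powr (- e)) ^ 4"
      using C(3)[OF np] le_C[OF np] by (intro mult_mono power_mono) auto
    also have "\<dots> = exp C * C ^ 4 * real n powr (- e')"
      using C(2) np f(3) by (simp add: power_mult_distrib powr_power)
    finally show "norm (exp (f n p) - (1 + f n p + f n p ^ 2 / 2 + f n p ^ 3 / 6)) \<le> exp C * C ^ 4 * real n powr (- e')" .
  qed
qed

text \<open>
  Bounded sequences with increments \<open>O(n powr - s)\<close>; for \<open>s > 1\<close> they are of bounded variation,
  which is what summation by parts needs.  They form an algebra.
\<close>

definition uniform_bv :: "'p set \<Rightarrow> real \<Rightarrow> (nat \<Rightarrow> 'p \<Rightarrow> complex) \<Rightarrow> bool" where
  "uniform_bv K s f \<longleftrightarrow> uniform_bigo K 0 f \<and> uniform_bigo K s (\<lambda>n p. f (Suc n) p - f n p)"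

lemma uniform_bv_const: "uniform_bv K s (\<lambda>n p. c)"
  by (auto simp: uniform_bv_def uniform_bigo_const intro: uniform_bigoI[of 0 _ _ 0])

lemma uniform_bv_bigo: "uniform_bigo K s f \<Longrightarrow> s \<ge> 0 \<Longrightarrow> uniform_bv K s f"
  unfolding uniform_bv_def by (auto intro: uniform_bigo_mono uniform_bigo_diff uniform_bigo_Suc)

lemma uniform_bv_add: "uniform_bv K s f \<Longrightarrow> uniform_bv K s g \<Longrightarrow> uniform_bv K s (\<lambda>n p. f n p + g n p)"
  unfolding uniform_bv_def
  by (auto intro: uniform_bigo_add
      uniform_bigo_cong[OF uniform_bigo_add[of K s "\<lambda>n p. f (Suc n) p - f n p" "\<lambda>n p. g (Suc n) p - g n p"]])

lemma uniform_bv_mult: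
  assumes "uniform_bv K s f" "uniform_bv K s g"
  shows "uniform_bv K s (\<lambda>n p. f n p * g n p)"
proof -
  have f: "uniform_bigo K 0 f" "uniform_bigo K s (\<lambda>n p. f (Suc n) p - f n p)"
    and g: "uniform_bigo K 0 g" "uniform_bigo K s (\<lambda>n p. g (Suc n) p - g n p)"
    using assms by (auto simp: uniform_bv_def)
  have "uniform_bigo K s (\<lambda>n p. (f (Suc n) p - f n p) * g (Suc n) p + f n p * (g (Suc n) p - g n p))"
    by (intro uniform_bigo_add uniform_bigo_mult[OF f(2) uniform_bigo_Suc[OF g(1)]] uniform_bigo_mult[OF f(1) g(2)]) auto
  hence "uniform_bigo K s (\<lambda>n p. f (Suc n) p * g (Suc n) p - f n p * g n p)"
    by (simp add: algebra_simps)
  thus ?thesis unfolding uniform_bv_def using uniform_bigo_mult[OF f(1) g(1)] by simp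
qed

lemma uniform_bv_Suc: "uniform_bv K s f \<Longrightarrow> s \<ge> 0 \<Longrightarrow> uniform_bv K s (\<lambda>n. f (Suc n))"
  unfolding uniform_bv_def
  using uniform_bigo_Suc[of K 0 f] uniform_bigo_Suc[of K s "\<lambda>n p. f (Suc n) p - f n p"] by simp

lemma uniform_bv_poly:
  assumes "uniform_bv K s f"
  shows "uniform_bv K s (\<lambda>n p. poly q (f n p))"
  by (induction q) (simp_all add: uniform_bv_const uniform_bv_add uniform_bv_mult assms)

lemma uniform_bv_inverse:
  assumes f: "uniform_bv K s f" and c: "c > 0" "\<And>n p. n \<ge> N \<Longrightarrow> p \<in> K \<Longrightarrow> c \<le> norm (f n p)"
  shows "uniform_bv K s (\<lambda>n p. 1 / f n p)"
proof -
  have 1: "uniform_bigo K 0 (\<lambda>n p. 1 / f n p)"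
  proof (rule uniform_bigoI[of "max N 1" _ _ "1 / c"])
    fix n p assume "max N 1 \<le> n" "p \<in> K"
    thus "norm (1 / f n p) \<le> 1 / c * real n powr - 0"
      using c(1) c(2)[of n p] by (auto simp: norm_divide intro!: divide_left_mono mult_pos_pos)
  qed
  have "uniform_bigo K s (\<lambda>n p. (- 1 * (f (Suc n) p - f n p)) * (1 / f n p * (1 / f (Suc n) p)))"
    using f unfolding uniform_bv_def
    by (intro uniform_bigo_mult[of _ s _ 0] uniform_bigo_mult[of _ 0 _ 0] uniform_bigo_cmult 1 uniform_bigo_Suc[OF 1]) auto
  hence "uniform_bigo K s (\<lambda>n p. 1 / f (Suc n) p - 1 / f n p)"
  proof (rule uniform_bigo_cong[where N = N])
    fix n p assume "n \<ge> N" "p \<in> K"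
    hence "f n p \<noteq> 0" "f (Suc n) p \<noteq> 0" using c(1) c(2)[of n p] c(2)[of "Suc n" p] by auto
    thus "1 / f (Suc n) p - 1 / f n p = (- 1 * (f (Suc n) p - f n p)) * (1 / f n p * (1 / f (Suc n) p))"
      by (simp add: field_simps)
  qed
  thus ?thesis using 1 by (simp add: uniform_bv_def)
qed

lemma abel_summation_bound:
  fixes q X :: "nat \<Rightarrow> complex"
  assumes X: "\<And>k. N \<le> k \<Longrightarrow> norm (X k) \<le> norm (X (Suc k))"
    and q: "\<And>k. N \<le> k \<Longrightarrow> norm (q k) \<le> C" "\<And>k. N \<le> k \<Longrightarrow> norm (q (Suc k) - q k) \<le> d k"
    and d: "\<And>k. d k \<ge> 0" "summable d"
    and n: "N \<le> n" "n \<le> m"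
  shows "norm (\<Sum>k\<in>{n..<m}. q k * (X (Suc k) - X k)) \<le> (2 * C + suminf d) * norm (X m)"
proof -
  have X_mono: "norm (X k) \<le> norm (X m)" if "N \<le> k" "k \<le> m" for k m
    using that(2,1) by (induction rule: dec_induct) (auto intro: order.trans[OF _ X])
  have parts: "(\<Sum>k\<in>{n..<m}. q k * (X (Suc k) - X k))
      = q m * X m - q n * X n - (\<Sum>k\<in>{n..<m}. (q (Suc k) - q k) * X (Suc k))"
    using n(2) by (induction rule: dec_induct) (auto simp: algebra_simps)
  have "norm (\<Sum>k\<in>{n..<m}. (q (Suc k) - q k) * X (Suc k)) \<le> (\<Sum>k\<in>{n..<m}. d k * norm (X m))"
    using n q(2) X_mono d(1) by (intro order.trans[OF norm_sum] sum_mono) (auto simp: norm_mult intro!: mult_mono)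
  also have "\<dots> = sum d {n..<m} * norm (X m)" by (simp add: sum_distrib_right)
  also have "\<dots> \<le> suminf d * norm (X m)" using d by (intro mult_right_mono sum_le_suminf) auto
  finally have 1: "norm (\<Sum>k\<in>{n..<m}. (q (Suc k) - q k) * X (Suc k)) \<le> suminf d * norm (X m)" .
  have C0: "0 \<le> C" using q(1)[of N] norm_ge_zero[of "q N"] by linarith
  have 2: "norm (q m * X m) \<le> C * norm (X m)" using q(1)[of m] n by (auto simp: norm_mult intro: mult_right_mono)
  have 3: "norm (q n * X n) \<le> C * norm (X m)" using q(1)[of n] n X_mono[of n m] C0 by (auto simp: norm_mult intro: mult_mono)
  show ?thesis unfolding parts
    using norm_triangle_ineq4[of "q m * X m - q n * X n" "\<Sum>k\<in>{n..<m}. (q (Suc k) - q k) * X (Suc k)"]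
      norm_triangle_ineq4[of "q m * X m" "q n * X n"] 1 2 3 by (simp add: algebra_simps)
qed

section \<open>The relative residual of the Ansatz\<close>

locale critical_jacobi =
  fixes a b ra rb :: "nat \<Rightarrow> real" and \<gamma> \<sigma> \<alpha> \<beta> \<tau> \<rho> :: real
  assumes \<gamma>: "\<gamma> \<in> {1, - 1}" and \<sigma>: "1 < \<sigma>" "\<sigma> \<le> 3 / 2"
    and a_pos: "\<And>n. a n > 0"
    and a_eq: "\<And>n. n \<ge> 1 \<Longrightarrow> a n = real n powr \<sigma> * (1 + \<alpha> / real n + ra n)"
    and ra: "ra \<in> O(\<lambda>n. 1 / real n ^ 2)"
    and b_eq: "\<And>n. n \<ge> 1 \<Longrightarrow> b n = 2 * \<gamma> * real n powr \<sigma> * (1 + \<beta> / real n + rb n)"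
    and rb: "rb \<in> O(\<lambda>n. 1 / real n ^ 2)"
    and \<tau>: "\<tau> = 2 * \<beta> - 2 * \<alpha> + \<sigma>"
    and \<rho>: "\<rho> = \<sigma> / 2 - 1 / 4"
begin

lemma \<gamma>_square: "\<gamma> * \<gamma> = 1" and \<gamma>_abs: "\<bar>\<gamma>\<bar> = 1"
  using \<gamma> by auto

lemma bigo_power2_iff: "f \<in> O(\<lambda>n. 1 / real n ^ 2) \<longleftrightarrow> f \<in> O(\<lambda>n. real n powr (- 2))"
proof -
  have "(\<lambda>n. 1 / real n ^ 2) \<in> \<Theta>(\<lambda>n. real n powr (- 2))" by real_asymp
  thus ?thesis by (simp add: landau_o.big.cong_bigtheta)
qed

lemma left_coefficient_expansion:
  "(\<lambda>n. a (n - 1) / real n powr \<sigma> * ((real n - 1) / real n) powr (- \<rho>) - (1 + (\<alpha> - \<sigma> + \<rho>) / real n))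
     \<in> O(\<lambda>n. real n powr (- 2))"
proof -
  let ?x = "\<lambda>n. (real n - 1) / real n"
  have "(\<lambda>n. ?x n powr (\<sigma> - \<rho>) * (1 + \<alpha> / (real n - 1)) - (1 + (\<alpha> - \<sigma> + \<rho>) / real n))
      \<in> O(\<lambda>n. real n powr (- 2))" by real_asymp
  moreover have "(\<lambda>n. ?x n powr (\<sigma> - \<rho>) * ra (n - 1)) \<in> O(\<lambda>n. 1 * real n powr (- 2))"
  proof (rule landau_o.big.mult)
    have "filterlim (\<lambda>n::nat. n - 1) sequentially sequentially"
      unfolding filterlim_at_top eventually_sequentially
    proof safe
      fix Z :: nat
      show "\<exists>N. \<forall>n\<ge>N. Z \<le> n - 1" by (rule exI[of _ "Z + 1"]) auto
    qed
    hence "(\<lambda>n. ra (n - 1)) \<in> O(\<lambda>n. real (n - 1) powr (- 2))"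
      using ra unfolding bigo_power2_iff by (rule landau_o.big.compose[rotated])
    also have "(\<lambda>n. real (n - 1) powr (- 2)) \<in> O(\<lambda>n. (real n - 1) powr (- 2))"
      by (rule landau_o.bigI[of 1]) (auto simp: eventually_sequentially of_nat_diff intro!: exI[of _ 1])
    also have "(\<lambda>n. (real n - 1) powr (- 2)) \<in> O(\<lambda>n. real n powr (- 2))" by real_asymp
    finally show "(\<lambda>n. ra (n - 1)) \<in> O(\<lambda>n. real n powr (- 2))" .
    show "(\<lambda>n. ?x n powr (\<sigma> - \<rho>)) \<in> O(\<lambda>_. 1)" by real_asymp
  qed
  hence "(\<lambda>n. ?x n powr (\<sigma> - \<rho>) * ra (n - 1)) \<in> O(\<lambda>n. real n powr (- 2))" by simp
  ultimately have "(\<lambda>n. (?x n powr (\<sigma> - \<rho>) * (1 + \<alpha> / (real n - 1)) - (1 + (\<alpha> - \<sigma> + \<rho>) / real n))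
      + ?x n powr (\<sigma> - \<rho>) * ra (n - 1)) \<in> O(\<lambda>n. real n powr (- 2))" by (rule sum_in_bigo)
  moreover have ev: "\<forall>\<^sub>F n in sequentially.
      (?x n powr (\<sigma> - \<rho>) * (1 + \<alpha> / (real n - 1)) - (1 + (\<alpha> - \<sigma> + \<rho>) / real n))
        + ?x n powr (\<sigma> - \<rho>) * ra (n - 1)
      = a (n - 1) / real n powr \<sigma> * ?x n powr (- \<rho>) - (1 + (\<alpha> - \<sigma> + \<rho>) / real n)"
    using eventually_ge_at_top[of 2]
  proof eventually_elim
    case (elim n)
    define w where "w = 1 + \<alpha> / (real n - 1) + ra (n - 1)"
    have "a (n - 1) = (real n - 1) powr \<sigma> * w"
      using elim a_eq[of "n - 1"] by (simp add: of_nat_diff w_def)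
    hence "a (n - 1) / real n powr \<sigma> * ?x n powr (- \<rho>) = ?x n powr (\<sigma> - \<rho>) * w"
      using elim by (simp add: powr_divide powr_diff powr_minus field_simps)
    hence "a (n - 1) / real n powr \<sigma> * ?x n powr (- \<rho>)
        = ?x n powr (\<sigma> - \<rho>) * (1 + \<alpha> / (real n - 1) + ra (n - 1))"
      unfolding w_def .
    thus ?case by (simp add: algebra_simps)
  qed
  ultimately show ?thesis using landau_o.big.in_cong[OF ev] by blast
qed

lemma right_coefficient_expansion:
  "(\<lambda>n. a n / real n powr \<sigma> * ((real n + 1) / real n) powr c - (1 + (\<alpha> + c) / real n))
     \<in> O(\<lambda>n. real n powr (- 2))"
proof -
  let ?x = "\<lambda>n. (real n + 1) / real n"
  have "(\<lambda>n. ?x n powr c * (1 + \<alpha> / real n) - (1 + (\<alpha> + c) / real n)) \<in> O(\<lambda>n. real n powr (- 2))"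
    by real_asymp
  moreover have "(\<lambda>n. ?x n powr c * ra n) \<in> O(\<lambda>n. 1 * real n powr (- 2))"
  proof (rule landau_o.big.mult)
    show "ra \<in> O(\<lambda>n. real n powr (- 2))" using ra bigo_power2_iff by simp
    show "(\<lambda>n. ?x n powr c) \<in> O(\<lambda>_. 1)" by real_asymp
  qed
  hence "(\<lambda>n. ?x n powr c * ra n) \<in> O(\<lambda>n. real n powr (- 2))" by simp
  ultimately have "(\<lambda>n. (?x n powr c * (1 + \<alpha> / real n) - (1 + (\<alpha> + c) / real n)) + ?x n powr c * ra n)
      \<in> O(\<lambda>n. real n powr (- 2))" by (rule sum_in_bigo)
  moreover have ev: "\<forall>\<^sub>F n in sequentially.
      (?x n powr c * (1 + \<alpha> / real n) - (1 + (\<alpha> + c) / real n)) + ?x n powr c * ra n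
      = a n / real n powr \<sigma> * ?x n powr c - (1 + (\<alpha> + c) / real n)"
    using eventually_ge_at_top[of 1] by eventually_elim (simp add: a_eq field_simps)
  ultimately show ?thesis using landau_o.big.in_cong[OF ev] by blast
qed

end

text \<open>
  A phase increment \<open>\<theta>\<close> is admissible on \<open>K\<close> if \<open>\<theta>\<^sub>n\<^sup>2\<close> equals \<open>t\<^sub>n\<close> to sufficient accuracy, if
  \<open>n\<^sup>1\<^sup>/\<^sup>2 \<theta>\<^sub>n\<close> is bounded away from \<open>0\<close> and varies slowly, and if \<open>exp (\<i> \<phi>\<^sub>n)\<close> does not grow.
  Freedom in the choice of \<open>\<theta>\<close> is needed because the square roots themselves are not entire in the
  spectral parameter.  The exponents are those that lead to a Volterra kernel of order
  \<open>m powr (- \<sigma>)\<close>, which is summable as \<open>\<sigma> > 1\<close>.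
\<close>

locale admissible_phase = critical_jacobi +
  fixes K :: "'p set" and \<zeta> :: "'p \<Rightarrow> complex" and \<theta> :: "nat \<Rightarrow> 'p \<Rightarrow> complex" and R c :: real
  assumes \<zeta>_bound: "\<And>p. p \<in> K \<Longrightarrow> norm (\<zeta> p) \<le> R"
    and \<theta>_bound: "\<And>n. \<exists>B. \<forall>p\<in>K. norm (\<theta> n p) \<le> B"
    and \<theta>_order: "uniform_bigo K (1 / 2) \<theta>"
    and c_pos: "c > 0"
    and \<theta>_lower: "\<forall>\<^sub>F n in sequentially. \<forall>p\<in>K. c \<le> norm (of_real (sqrt (real n)) * \<theta> n p)"
    and \<theta>_slow: "uniform_bigo K \<sigma>
      (\<lambda>n p. of_real (sqrt (real (Suc n))) * \<theta> (Suc n) p - of_real (sqrt (real n)) * \<theta> n p)"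
    and \<theta>_square: "uniform_bigo K (\<sigma> + 1 / 2) (\<lambda>n p. \<theta> n p ^ 2 - t_seq \<sigma> \<tau> n (of_real \<gamma> * \<zeta> p))"
    and Im_\<theta>: "\<forall>\<^sub>F n in sequentially. \<forall>p\<in>K. 0 \<le> Im (\<theta> n p)"
begin

definition phase :: "nat \<Rightarrow> 'p \<Rightarrow> complex" where
  "phase n p = (\<Sum>m=1..n. \<theta> m p)"

definition approx :: "nat \<Rightarrow> 'p \<Rightarrow> complex" where
  "approx n p = ansatz \<gamma> \<rho> n (phase n p)"

lemma phase_Suc: "phase (Suc n) p = phase n p + \<theta> (Suc n) p"
  by (simp add: phase_def)

lemma approx_nonzero: "n \<ge> 1 \<Longrightarrow> approx n p \<noteq> 0"
  using \<gamma> by (auto simp: approx_def ansatz_def)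

lemma approx_Suc:
  assumes "n \<ge> 1"
  shows "approx (Suc n) p = - of_real \<gamma> * of_real (((real n + 1) / real n) powr (- \<rho>)) * exp (\<i> * \<theta> (Suc n) p) * approx n p"
proof -
  have "real (Suc n) powr (- \<rho>) = ((real n + 1) / real n) powr (- \<rho>) * real n powr (- \<rho>)"
    using assms by (simp add: powr_divide add.commute)
  thus ?thesis unfolding approx_def ansatz_def phase_Suc by (simp add: distrib_left exp_add)
qed

lemma approx_pred:
  assumes "n \<ge> 2"
  shows "approx (n - 1) p = - of_real \<gamma> * of_real (((real n - 1) / real n) powr (- \<rho>)) * exp (- (\<i> * \<theta> n p)) * approx n p"
proof -
  obtain k where k: "n = Suc k" "k \<ge> 1" using assms by (cases n) auto
  have 1: "((real n - 1) / real n) powr (- \<rho>) * ((real k + 1) / real k) powr (- \<rho>) = 1"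
    using k by (simp add: powr_divide field_simps)
  have "- of_real \<gamma> * of_real (((real n - 1) / real n) powr (- \<rho>)) * exp (- (\<i> * \<theta> n p)) * approx n p
      = of_real (\<gamma> * \<gamma>) * of_real (((real n - 1) / real n) powr (- \<rho>) * ((real k + 1) / real k) powr (- \<rho>))
        * (exp (- (\<i> * \<theta> n p)) * exp (\<i> * \<theta> n p)) * approx k p"
    using approx_Suc[OF k(2), of p] by (simp add: k(1))
  also have "\<dots> = approx k p" unfolding 1 \<gamma>_square by (simp flip: exp_add)
  finally show ?thesis using k by simp
qed

definition residual :: "nat \<Rightarrow> 'p \<Rightarrow> complex" where
  "residual n p = of_real (a (n - 1)) * approx (n - 1) p + (of_real (b n) - \<zeta> p) * approx n p + of_real (a n) * approx (n + 1) p"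

text \<open>
  Slow variation of \<open>n\<^sup>1\<^sup>/\<^sup>2 \<theta>\<^sub>n\<close> says that \<open>\<theta>\<^sub>n\<close> decays like \<open>n powr (- 1 / 2)\<close> also to first order in its
  increments.
\<close>

lemma \<theta>_increment:
  "uniform_bigo K (\<sigma> + 1 / 2) (\<lambda>n p. \<theta> (Suc n) p - \<theta> n p * (1 - 1 / (2 * of_nat n)))"
proof -
  define \<psi> where "\<psi> = (\<lambda>n p. of_real (sqrt (real n)) * \<theta> n p)"
  define x where "x = (\<lambda>n. 1 / sqrt (real n + 1))"
  define y where "y = (\<lambda>n. 1 / sqrt (real n + 1) - 1 / sqrt (real n) * (1 - 1 / (2 * real n)))"
  have "uniform_bigo K (- (1 / 2)) (\<lambda>n (p::'p). of_real (sqrt (real n)))"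
    by (rule uniform_bigo_of_real) real_asymp
  hence \<psi>: "uniform_bigo K 0 \<psi>"
    unfolding \<psi>_def by (rule uniform_bigo_mult[OF _ \<theta>_order]) simp
  have x: "uniform_bigo K (1 / 2) (\<lambda>n (p::'p). of_real (x n))"
    unfolding x_def by (rule uniform_bigo_of_real) real_asymp
  have "uniform_bigo K (5 / 2) (\<lambda>n (p::'p). of_real (y n))"
    unfolding y_def by (rule uniform_bigo_of_real) real_asymp
  hence y: "uniform_bigo K (\<sigma> + 1 / 2) (\<lambda>n (p::'p). of_real (y n))"
    by (rule uniform_bigo_mono) (use \<sigma> in simp)
  have slow: "uniform_bigo K \<sigma> (\<lambda>n p. \<psi> (Suc n) p - \<psi> n p)"
    using \<theta>_slow unfolding \<psi>_def .
  have "uniform_bigo K (\<sigma> + 1 / 2) (\<lambda>n p. (\<psi> (Suc n) p - \<psi> n p) * of_real (x n) + \<psi> n p * of_real (y n))"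
    by (intro uniform_bigo_add uniform_bigo_mult[OF slow x] uniform_bigo_mult[OF \<psi> y]) auto
  thus ?thesis
  proof (rule uniform_bigo_cong[where N = 1])
    fix n p assume n: "n \<ge> (1::nat)"
    have 1: "sqrt (real (Suc n)) * x n = 1" "sqrt (real n) * (x n - y n) = 1 - 1 / (2 * real n)"
      using n by (auto simp: x_def y_def add.commute)
    have "(\<psi> (Suc n) p - \<psi> n p) * of_real (x n) + \<psi> n p * of_real (y n)
        = \<theta> (Suc n) p * of_real (sqrt (real (Suc n)) * x n) - \<theta> n p * of_real (sqrt (real n) * (x n - y n))"
      by (simp add: \<psi>_def algebra_simps)
    thus "\<theta> (Suc n) p - \<theta> n p * (1 - 1 / (2 * of_nat n))
        = (\<psi> (Suc n) p - \<psi> n p) * of_real (x n) + \<psi> n p * of_real (y n)"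
      unfolding 1 by simp
  qed
qed

text \<open>
  With \<open>f = - \<i> \<theta>\<^sub>n\<close> and \<open>g = \<i> \<theta>\<^sub>n\<^sub>+\<^sub>1\<close> the residual is a second difference of exponentials.  The
  terms \<open>f + g\<close> of order \<open>n powr - (3 / 2)\<close> cancel against the first order terms of the coefficients
  by the choice of \<open>\<rho>\<close>, and what remains at order \<open>1 / n\<close> is \<open>t\<^sub>n - \<theta>\<^sub>n\<^sup>2\<close>.
\<close>

lemma residual_bound:
  "uniform_bigo K (\<sigma> + 1 / 2) (\<lambda>n p. residual n p / (of_real (real n powr \<sigma>) * approx n p))"
proof -
  define \<nu> where "\<nu> = (\<lambda>n (p::'p). of_real (1 / real n) :: complex)"
  define x y where "x = \<alpha> - \<sigma> + \<rho>" and "y = \<alpha> - \<rho>"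
  define X where "X = (\<lambda>n. a (n - 1) / real n powr \<sigma> * ((real n - 1) / real n) powr (- \<rho>))"
  define Y where "Y = (\<lambda>n. a n / real n powr \<sigma> * ((real n + 1) / real n) powr (- \<rho>))"
  define f g where "f = (\<lambda>n p. - \<i> * \<theta> n p)" and "g = (\<lambda>n p. \<i> * \<theta> (Suc n) p)"
  define h where "h = (\<lambda>n p. f n p + g n p)"
  define Ef Eg where "Ef = (\<lambda>n p. exp (f n p) - (1 + f n p + f n p ^ 2 / 2 + f n p ^ 3 / 6))"
    and "Eg = (\<lambda>n p. exp (g n p) - (1 + g n p + g n p ^ 2 / 2 + g n p ^ 3 / 6))"
  define \<delta> where "\<delta> = (\<lambda>n p. \<theta> (Suc n) p - \<theta> n p * (1 - 1 / (2 * of_nat n)))"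
  define t where "t = (\<lambda>n p. t_seq \<sigma> \<tau> n (of_real \<gamma> * \<zeta> p))"
  note mult = uniform_bigo_mult
  have s2: "\<sigma> + 1 / 2 \<le> 2" using \<sigma> by simp
  have \<nu>: "uniform_bigo K 1 \<nu>"
    unfolding \<nu>_def by (rule uniform_bigo_of_real) real_asymp
  have X: "uniform_bigo K 2 (\<lambda>n (p::'p). of_real (X n - (1 + x / real n)))"
    unfolding X_def x_def by (rule uniform_bigo_of_real) (rule left_coefficient_expansion)
  have Y: "uniform_bigo K 2 (\<lambda>n (p::'p). of_real (Y n - (1 + y / real n)))"
    unfolding Y_def y_def using right_coefficient_expansion[of "- \<rho>"] by (intro uniform_bigo_of_real) simp
  have rb': "uniform_bigo K 2 (\<lambda>n (p::'p). of_real (rb n))"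
    using rb unfolding bigo_power2_iff by (rule uniform_bigo_of_real)
  have f: "uniform_bigo K (1 / 2) f" and g: "uniform_bigo K (1 / 2) g"
    unfolding f_def g_def by (intro uniform_bigo_cmult \<theta>_order uniform_bigo_Suc[OF \<theta>_order]; simp)+
  have f1: "uniform_bigo K 1 (\<lambda>n p. f n p ^ 2)" "uniform_bigo K 1 (\<lambda>n p. f n p ^ 3)"
    and g1: "uniform_bigo K 1 (\<lambda>n p. g n p ^ 2)" "uniform_bigo K 1 (\<lambda>n p. g n p ^ 3)"
    by (intro uniform_bigo_power[OF f] uniform_bigo_power[OF g]
        uniform_bigo_mono[OF uniform_bigo_power[OF f refl]] uniform_bigo_mono[OF uniform_bigo_power[OF g refl]]; simp)+
  have Ef: "uniform_bigo K 2 Ef" and Eg: "uniform_bigo K 2 Eg"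
    unfolding Ef_def Eg_def by (intro uniform_bigo_exp_Taylor[OF f] uniform_bigo_exp_Taylor[OF g]; simp)+
  have ef: "uniform_bigo K 0 (\<lambda>n p. exp (f n p))" and eg: "uniform_bigo K 0 (\<lambda>n p. exp (g n p))"
    by (rule uniform_bigo_exp_Taylor[OF f] uniform_bigo_exp_Taylor[OF g]; simp)+
  have ef1: "uniform_bigo K 1 (\<lambda>n p. Ef n p + (1 / 2) * f n p ^ 2 + (1 / 6) * f n p ^ 3)"
    and eg1: "uniform_bigo K 1 (\<lambda>n p. Eg n p + (1 / 2) * g n p ^ 2 + (1 / 6) * g n p ^ 3)"
    by (intro uniform_bigo_add uniform_bigo_cmult f1 g1 uniform_bigo_mono[OF Ef] uniform_bigo_mono[OF Eg]; simp)+
  have \<delta>: "uniform_bigo K (\<sigma> + 1 / 2) \<delta>" unfolding \<delta>_def by (rule \<theta>_increment)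
  have h_eq: "h n p = (1 / 2) * (\<nu> n p * f n p) + \<i> * \<delta> n p" for n p
    by (simp add: h_def f_def g_def \<delta>_def \<nu>_def algebra_simps)
  have h: "uniform_bigo K (3 / 2) h"
    unfolding h_eq by (intro uniform_bigo_add uniform_bigo_cmult mult[OF \<nu> f] uniform_bigo_mono[OF \<delta>])
       (use \<sigma> in auto)
  have sq: "uniform_bigo K (\<sigma> + 1 / 2) (\<lambda>n p. \<theta> n p ^ 2 - t n p)"
    unfolding t_def by (rule \<theta>_square)
  define S where "S = (\<lambda>n p. of_real (X n) * exp (f n p) + of_real (Y n) * exp (g n p)
      - 2 * (1 + of_real \<beta> * \<nu> n p + of_real (rb n)) + of_real \<gamma> * \<zeta> p * of_real (real n powr (- \<sigma>)))"
  define r where "r = (\<lambda>n p. of_real (X n - (1 + x / real n)) * exp (f n p)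
      + of_real (Y n - (1 + y / real n)) * exp (g n p)
      + of_real x * (\<nu> n p * (Ef n p + (1 / 2) * f n p ^ 2 + (1 / 6) * f n p ^ 3))
      + of_real y * (\<nu> n p * (Eg n p + (1 / 2) * g n p ^ 2 + (1 / 6) * g n p ^ 3))
      + Ef n p + Eg n p + (1 / 2) * (h n p * (g n p - f n p))
      + (1 / 6) * (h n p * (f n p ^ 2 - f n p * g n p + g n p ^ 2))
      + of_real y * (\<nu> n p * h n p) - 2 * of_real (rb n))"
  have "uniform_bigo K 2 r"
    unfolding r_def
  proof (intro uniform_bigo_add uniform_bigo_diff uniform_bigo_cmult Ef Eg rb')
    show "uniform_bigo K 2 (\<lambda>n p. h n p * (f n p ^ 2 - f n p * g n p + g n p ^ 2))"
      by (rule uniform_bigo_mono[OF mult[OF h _ refl], of 1])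
         (auto intro!: uniform_bigo_add uniform_bigo_diff f1 g1 mult[OF f g])
    show "uniform_bigo K 2 (\<lambda>n p. \<nu> n p * h n p)"
      by (rule uniform_bigo_mono[OF mult[OF \<nu> h refl]]) simp
  qed (rule mult[OF X ef] mult[OF Y eg] mult[OF \<nu> ef1] mult[OF \<nu> eg1] mult[OF h uniform_bigo_diff[OF g f]]; simp)+
  hence "uniform_bigo K (\<sigma> + 1 / 2) (\<lambda>n p. r n p + \<i> * \<delta> n p - (\<theta> n p ^ 2 - t n p))"
    by (intro uniform_bigo_add uniform_bigo_diff uniform_bigo_cmult \<delta> sq uniform_bigo_mono[OF _ s2])
  moreover have "S n p = r n p + \<i> * \<delta> n p - (\<theta> n p ^ 2 - t n p)" if "n \<ge> 1" for n p
  proof -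
    have e: "exp (f n p) = Ef n p + (1 + f n p + f n p ^ 2 / 2 + f n p ^ 3 / 6)"
      "exp (g n p) = Eg n p + (1 + g n p + g n p ^ 2 / 2 + g n p ^ 3 / 6)"
      by (simp_all add: Ef_def Eg_def)
    have th: "\<theta> n p ^ 2 = - (f n p ^ 2)" by (simp add: f_def power_mult_distrib)
    have d: "\<i> * \<delta> n p = f n p + g n p - (1 / 2) * (\<nu> n p * f n p)"
      using h_eq[of n p] by (simp add: h_def)
    have t: "t n p = - of_real \<tau> * \<nu> n p + of_real \<gamma> * \<zeta> p * of_real (real n powr (- \<sigma>))"
      by (simp add: t_def t_seq_def \<nu>_def)
    have XY: "of_real (X n - (1 + x / real n)) = of_real (X n) - (1 + of_real x * \<nu> n p)"
      "of_real (Y n - (1 + y / real n)) = of_real (Y n) - (1 + of_real y * \<nu> n p)"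
      by (simp_all add: \<nu>_def)
    have ys: "(of_real y :: complex) = of_real x + 1 / 2"
      by (simp add: x_def y_def \<rho>)
    have bs: "(of_real \<beta> :: complex) = of_real \<tau> / 2 + of_real x + 1 / 4"
      by (simp add: x_def \<rho> \<tau> field_simps)
    show ?thesis
      unfolding S_def r_def XY d th t h_def ys bs e
      by (simp add: field_simps power2_eq_square power3_eq_cube)
  qed
  ultimately have "uniform_bigo K (\<sigma> + 1 / 2) S"
    by (rule uniform_bigo_cong[where N = 1]) auto
  hence "uniform_bigo K (\<sigma> + 1 / 2) (\<lambda>n p. - of_real \<gamma> * S n p)" by (rule uniform_bigo_cmult)
  thus ?thesis
  proof (rule uniform_bigo_cong[where N = 2])
    fix n p assume n: "n \<ge> (2::nat)"
    define v where "v = (of_real (real n powr \<sigma>) :: complex)"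
    have v: "v \<noteq> 0" "of_real (real n powr (- \<sigma>)) = 1 / v"
      using n by (simp_all add: v_def powr_minus divide_inverse)
    have b: "of_real (b n) = 2 * of_real \<gamma> * v * (1 + of_real \<beta> * \<nu> n p + of_real (rb n))"
      using b_eq[of n] n by (simp add: v_def \<nu>_def)
    have gg: "(of_real \<gamma> :: complex) * of_real \<gamma> = 1" by (metis \<gamma>_square of_real_1 of_real_mult)
    have g2: "of_real \<gamma> * (of_real \<gamma> * w) = w" for w :: complex using gg by (simp flip: mult.assoc)
    have aX: "of_real (a (n - 1)) * approx (n - 1) p = - of_real \<gamma> * v * (of_real (X n) * exp (f n p)) * approx n p"
      unfolding approx_pred[OF n] using v by (simp add: X_def f_def v_def)
    have aY: "of_real (a n) * approx (n + 1) p = - of_real \<gamma> * v * (of_real (Y n) * exp (g n p)) * approx n p"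
      using n v by (simp add: approx_Suc Y_def g_def v_def)
    have "residual n p = - of_real \<gamma> * v * S n p * approx n p"
      unfolding residual_def aX aY b S_def v(2) using v(1) by (simp add: algebra_simps g2)
    thus "residual n p / (of_real (real n powr \<sigma>) * approx n p) = - of_real \<gamma> * S n p"
      using v(1) approx_nonzero[of n p] n by (simp add: v_def)
  qed
qed

end

section \<open>The Volterra kernel and the solution attached to an admissible phase\<close>

context admissible_phase
begin

text \<open>
  The square of the reciprocal of the exponential factor.  From some rank on its modulus does not
  decrease, because the phase increments have nonnegative imaginary parts there.
\<close>

definition X :: "nat \<Rightarrow> 'p \<Rightarrow> complex" where
  "X n p = exp (- 2 * \<i> * phase n p)"

definition weight :: "nat \<Rightarrow> 'p \<Rightarrow> complex" where
  "weight n p = of_real (a n * real n powr (- \<rho>) * real (Suc n) powr (- \<rho>)) * sin (\<theta> (Suc n) p)"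

text \<open>
  The sum in the kernel is a discrete version of the integral of \<open>exp (- 2 * \<i> * \<phi>)\<close> against \<open>d\<phi>\<close>,
  which has an elementary primitive: \<open>X\<close> plays this role without error, at the price of a weight
  which contains a sine.
\<close>

lemma reciprocal_Wronskian_weight:
  assumes "n \<ge> 1" "sin (\<theta> (Suc n) p) \<noteq> 0"
  shows "1 / (of_real (a n) * approx n p * approx (Suc n) p)
    = of_real \<gamma> / (2 * \<i>) * (1 / weight n p) * (X (Suc n) p - X n p)"
proof -
  define e where "e = exp (\<i> * (phase n p + phase (Suc n) p))"
  define s where "s = sin (\<theta> (Suc n) p)"
  define u v where "u = (of_real (real n powr (- \<rho>)) :: complex)"
    and "v = (of_real (real (Suc n) powr (- \<rho>)) :: complex)"
  have nz: "e \<noteq> 0" "s \<noteq> 0" "u \<noteq> 0" "v \<noteq> 0" "(of_real (a n) :: complex) \<noteq> 0" "(of_real \<gamma> :: complex) \<noteq> 0"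
    using assms a_pos[of n] \<gamma> by (auto simp: e_def s_def u_def v_def)
  have gg: "(of_real \<gamma> :: complex) * of_real \<gamma> = 1" by (metis \<gamma>_square of_real_1 of_real_mult)
  have "approx n p * approx (Suc n) p = of_real ((- \<gamma>) ^ n * (- \<gamma>) ^ Suc n) * u * v * e"
    unfolding approx_def ansatz_def e_def u_def v_def by (simp add: distrib_left exp_add)
  also have "(- \<gamma>) ^ n * (- \<gamma>) ^ Suc n = - \<gamma>"
    using \<gamma> by (auto simp flip: power_mult_distrib)
  finally have AA: "approx n p * approx (Suc n) p = - of_real \<gamma> * u * v * e" by simp
  have "X (Suc n) p - X n p = exp (- (\<i> * (phase n p + phase (Suc n) p)))
      * (exp (- (\<i> * \<theta> (Suc n) p)) - exp (\<i> * \<theta> (Suc n) p))"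
    unfolding X_def phase_Suc right_diff_distrib
    by (simp flip: exp_add) (simp add: algebra_simps)
  also have "exp (- (\<i> * (phase n p + phase (Suc n) p))) = 1 / e"
    by (simp add: e_def exp_minus inverse_eq_divide)
  also have "exp (- (\<i> * \<theta> (Suc n) p)) - exp (\<i> * \<theta> (Suc n) p) = - (2 * \<i> * s)"
    by (simp add: s_def sin_exp_eq)
  finally have XX: "X (Suc n) p - X n p = - (2 * \<i> * s) / e" by simp
  have w: "weight n p = of_real (a n) * u * v * s"
    by (simp add: weight_def u_def v_def s_def)
  have "of_real \<gamma> / (2 * \<i>) * (1 / weight n p) * (X (Suc n) p - X n p)
      = - of_real \<gamma> / (of_real (a n) * u * v * e)"
    unfolding XX w using nz by (simp add: field_simps)
  also have "\<dots> = 1 / (of_real (a n) * (- of_real \<gamma> * u * v * e))"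
    using nz gg by (simp add: field_simps)
  finally show ?thesis unfolding AA[symmetric] by (simp add: mult.assoc)
qed

text \<open>
  Since \<open>\<sigma> - 2 \<rho> = 1 / 2\<close>, the weight is \<open>n\<^sup>1\<^sup>/\<^sup>2 \<theta>\<^sub>n\<close> to leading order, and so inherits slow variation and
  the lower bound.  The sine has to be expanded to third order: its cubic term is only \<open>O(1 / n)\<close>
  in the weight, but varies slowly, and the rest is itself of order \<open>n powr (- 3 / 2)\<close>.
\<close>

lemma weight_expansion:
  shows weight_bv: "uniform_bv K \<sigma> weight"
    and weight_lower: "\<forall>\<^sub>F n in sequentially. \<forall>p\<in>K. c / 2 \<le> norm (weight n p)"
proof -
  define \<psi> where "\<psi> = (\<lambda>n p. of_real (sqrt (real n)) * \<theta> n p)"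
  define \<nu> where "\<nu> = (\<lambda>n (p::'p). of_real (1 / real n) :: complex)"
  define k where "k = \<alpha> - \<rho> - 1 / 2"
  define e where "e = (\<lambda>n. a n / real n powr \<sigma> * ((real n + 1) / real n) powr (- \<rho> - 1 / 2))"
  define \<eta> where "\<eta> = (\<lambda>n p. of_real (sqrt (real n)) * (sin (\<theta> n p) - \<theta> n p + \<theta> n p ^ 3 / 6))"
  note mult = uniform_bigo_mult
  have s: "\<sigma> \<ge> 0" "\<sigma> \<le> 2" "\<sigma> \<le> 3 / 2" using \<sigma> by auto
  have rt: "uniform_bigo K (- (1 / 2)) (\<lambda>n (p::'p). of_real (sqrt (real n)))"
    by (rule uniform_bigo_of_real) real_asymp
  have \<psi>0: "uniform_bigo K 0 \<psi>" unfolding \<psi>_def by (rule mult[OF rt \<theta>_order]) simp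
  have "uniform_bigo K \<sigma> (\<lambda>n p. \<psi> (Suc n) p - \<psi> n p)"
    using \<theta>_slow unfolding \<psi>_def .
  hence \<psi>: "uniform_bv K \<sigma> \<psi>" using \<psi>0 by (simp add: uniform_bv_def)
  have \<nu>1: "uniform_bigo K 1 \<nu>" unfolding \<nu>_def by (rule uniform_bigo_of_real) real_asymp
  have "uniform_bigo K 2 (\<lambda>n (p::'p). of_real (1 / (real n + 1) - 1 / real n))"
    by (rule uniform_bigo_of_real) real_asymp
  hence "uniform_bigo K \<sigma> (\<lambda>n p. \<nu> (Suc n) p - \<nu> n p)"
    using s(2) by (auto simp: \<nu>_def add.commute intro: uniform_bigo_mono)
  hence \<nu>: "uniform_bv K \<sigma> \<nu>" using uniform_bigo_mono[OF \<nu>1] by (simp add: uniform_bv_def)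
  have e2: "uniform_bigo K 2 (\<lambda>n (p::'p). of_real (e n - (1 + k / real n)))"
    unfolding e_def k_def using right_coefficient_expansion[of "- \<rho> - 1 / 2"]
    by (intro uniform_bigo_of_real) (simp add: algebra_simps)
  have "uniform_bv K \<sigma> (\<lambda>n p. of_real (e n - (1 + k / real n)) + (1 + of_real k * \<nu> n p))"
    using s by (intro uniform_bv_add uniform_bv_mult uniform_bv_const \<nu> uniform_bv_bigo uniform_bigo_mono[OF e2])
  hence e: "uniform_bv K \<sigma> (\<lambda>n (p::'p). of_real (e n))" by (simp add: \<nu>_def)
  have "uniform_bigo K 1 (\<lambda>n p. of_real (e n - (1 + k / real n)) + of_real k * \<nu> n p)"
    by (intro uniform_bigo_add uniform_bigo_cmult \<nu>1 uniform_bigo_mono[OF e2]) simp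
  hence e1: "uniform_bigo K 1 (\<lambda>n (p::'p). of_real (e n) - 1)" by (simp add: \<nu>_def)
  have i\<theta>: "uniform_bigo K (1 / 2) (\<lambda>n p. \<i> * \<theta> n p)" "uniform_bigo K (1 / 2) (\<lambda>n p. - \<i> * \<theta> n p)"
    by (intro uniform_bigo_cmult \<theta>_order)+
  have "uniform_bigo K 2 (\<lambda>n p. (1 / (2 * \<i>)) *
      ((exp (\<i> * \<theta> n p) - (1 + \<i> * \<theta> n p + (\<i> * \<theta> n p) ^ 2 / 2 + (\<i> * \<theta> n p) ^ 3 / 6))
       - (exp (- \<i> * \<theta> n p) - (1 + - \<i> * \<theta> n p + (- \<i> * \<theta> n p) ^ 2 / 2 + (- \<i> * \<theta> n p) ^ 3 / 6))))"
    by (intro uniform_bigo_cmult uniform_bigo_diff uniform_bigo_exp_Taylor(1)[OF i\<theta>(1)] uniform_bigo_exp_Taylor(1)[OF i\<theta>(2)]) auto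
  hence sin2: "uniform_bigo K 2 (\<lambda>n p. sin (\<theta> n p) - \<theta> n p + \<theta> n p ^ 3 / 6)"
    by (rule uniform_bigo_cong[where N = 0])
       (simp add: sin_exp_eq field_simps power2_eq_square power3_eq_cube)
  have \<eta>: "uniform_bigo K (3 / 2) \<eta>"
    unfolding \<eta>_def by (rule mult[OF rt sin2]) simp
  have W: "weight n p = of_real (e n) * (\<psi> (Suc n) p
      + (- 1 / 6) * (\<nu> (Suc n) p * (\<psi> (Suc n) p * (\<psi> (Suc n) p * \<psi> (Suc n) p))) + \<eta> (Suc n) p)"
    if "n \<ge> 1" for n p
  proof -
    define r where "r = (of_real (sqrt (real (Suc n))) :: complex)"
    have r: "r * r = of_nat (Suc n)" "r \<noteq> 0"
      unfolding r_def of_real_mult[symmetric] by simp_all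
    have "real n powr \<sigma> = real n powr \<rho> * real n powr \<rho> * real n powr (1 / 2)"
      unfolding powr_add[symmetric] by (simp add: \<rho>)
    moreover have "((real n + 1) / real n) powr (- \<rho> - 1 / 2)
        = (real n powr \<rho> * real n powr (1 / 2)) / (real (Suc n) powr \<rho> * sqrt (real (Suc n)))"
    proof -
      have x: "- \<rho> - 1 / 2 = - (\<rho> + 1 / 2)" by simp
      show ?thesis unfolding x powr_minus powr_add powr_divide
        using that by (simp add: powr_divide powr_half_sqrt add.commute)
    qed
    ultimately have "a n * real n powr (- \<rho>) * real (Suc n) powr (- \<rho>) = e n * sqrt (real (Suc n))"
      using that unfolding e_def by (simp add: powr_minus field_simps)
    hence 1: "weight n p = of_real (e n) * (r * sin (\<theta> (Suc n) p))"
      by (simp add: weight_def r_def)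
    have "\<nu> (Suc n) p * (\<psi> (Suc n) p * (\<psi> (Suc n) p * \<psi> (Suc n) p))
        = (r * r / of_nat (Suc n)) * (r * \<theta> (Suc n) p ^ 3)"
      by (simp add: \<nu>_def \<psi>_def r_def power3_eq_cube)
    also have "\<dots> = r * \<theta> (Suc n) p ^ 3" unfolding r(1) by (simp del: of_nat_Suc)
    finally show ?thesis unfolding 1 by (simp add: \<psi>_def \<eta>_def r_def algebra_simps)
  qed
  have W_bv: "uniform_bv K \<sigma> (\<lambda>n p. of_real (e n) * (\<psi> (Suc n) p
      + (- 1 / 6) * (\<nu> (Suc n) p * (\<psi> (Suc n) p * (\<psi> (Suc n) p * \<psi> (Suc n) p))) + \<eta> (Suc n) p))"
    using s by (intro uniform_bv_mult uniform_bv_add e uniform_bv_const uniform_bv_Suc[OF \<psi>] uniform_bv_Suc[OF \<nu>]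
        uniform_bv_Suc[OF uniform_bv_bigo] uniform_bigo_mono[OF \<eta>])
  show "uniform_bv K \<sigma> weight"
    using W_bv unfolding uniform_bv_def
    by (auto intro: uniform_bigo_cong[where N = 1] simp: W)
  have \<psi>S: "uniform_bigo K 0 (\<lambda>n. \<psi> (Suc n))" by (rule uniform_bigo_Suc[OF \<psi>0]) simp
  have \<nu>S: "uniform_bigo K 1 (\<lambda>n. \<nu> (Suc n))" by (rule uniform_bigo_Suc[OF \<nu>1]) simp
  have \<eta>S: "uniform_bigo K 1 (\<lambda>n. \<eta> (Suc n))"
    using uniform_bigo_Suc[OF uniform_bigo_mono[OF \<eta>, of 1]] by simp
  have e0: "uniform_bigo K 0 (\<lambda>n (p::'p). of_real (e n))" using e by (simp add: uniform_bv_def)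
  have inner: "uniform_bigo K 1 (\<lambda>n p.
     (- 1 / 6) * (\<nu> (Suc n) p * (\<psi> (Suc n) p * (\<psi> (Suc n) p * \<psi> (Suc n) p))) + \<eta> (Suc n) p)"
    by (intro uniform_bigo_add uniform_bigo_cmult \<eta>S mult[OF \<nu>S mult[OF \<psi>S mult[OF \<psi>S \<psi>S]]]) auto
  have "uniform_bigo K 1 (\<lambda>n p. (of_real (e n) - 1) * \<psi> (Suc n) p + of_real (e n) *
     ((- 1 / 6) * (\<nu> (Suc n) p * (\<psi> (Suc n) p * (\<psi> (Suc n) p * \<psi> (Suc n) p))) + \<eta> (Suc n) p))"
    by (intro uniform_bigo_add mult[OF e1 \<psi>S] mult[OF e0 inner]) auto
  hence "uniform_bigo K 1 (\<lambda>n p. weight n p - \<psi> (Suc n) p)"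
    by (rule uniform_bigo_cong[where N = 1]) (simp add: W algebra_simps)
  from uniform_bigo_eventually_small[OF this, of "c / 2"]
  have ev1: "\<forall>\<^sub>F n in sequentially. \<forall>p\<in>K. norm (weight n p - \<psi> (Suc n) p) < c / 2" using c_pos by simp
  have ev2: "\<forall>\<^sub>F n in sequentially. \<forall>p\<in>K. c \<le> norm (\<psi> (Suc n) p)"
    using \<theta>_lower unfolding \<psi>_def by (subst eventually_sequentially_Suc)
  show "\<forall>\<^sub>F n in sequentially. \<forall>p\<in>K. c / 2 \<le> norm (weight n p)"
    using ev1 ev2
  proof eventually_elim
    case (elim n)
    show ?case
    proof
      fix p assume "p \<in> K"
      hence "norm (\<psi> (Suc n) p - weight n p) < c / 2" "c \<le> norm (\<psi> (Suc n) p)"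
        using elim by (auto simp: norm_minus_commute)
      thus "c / 2 \<le> norm (weight n p)"
        using norm_triangle_ineq2[of "\<psi> (Suc n) p" "weight n p"] by linarith
    qed
  qed
qed

text \<open>
  Summation by parts: \<open>\<bar>X\<bar>\<close> is eventually nondecreasing, so the inner sum is dominated by its last term, and
  \<open>(approx m)\<^sup>2 X m\<close> has modulus \<open>m powr (- 2 * \<rho>)\<close>.  The exponential factors have disappeared and the
  bound on the residual leaves \<open>m powr (- \<sigma>)\<close>.
\<close>

lemma kernel_bound:
  obtains C N where "C \<ge> 0" "N \<ge> 1"
    "\<And>n m p. N \<le> n \<Longrightarrow> n < m \<Longrightarrow> p \<in> K \<Longrightarrow>
       norm (residual m p * approx m p * (\<Sum>k\<in>{n..<m}. 1 / (of_real (a k) * approx k p * approx (Suc k) p)))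
         \<le> C * real m powr (- \<sigma>)"
proof -
  obtain N1 where N1: "\<And>n p. n \<ge> N1 \<Longrightarrow> p \<in> K \<Longrightarrow> c / 2 \<le> norm (weight n p)"
    using weight_lower by (auto simp: eventually_sequentially)
  obtain N2 where N2: "\<And>n p. n \<ge> N2 \<Longrightarrow> p \<in> K \<Longrightarrow> 0 \<le> Im (\<theta> n p)"
    using Im_\<theta> by (auto simp: eventually_sequentially)
  define q where "q = (\<lambda>n p. of_real \<gamma> / (2 * \<i>) * (1 / weight n p))"
  have "uniform_bv K \<sigma> q"
    unfolding q_def using c_pos N1
    by (intro uniform_bv_mult uniform_bv_const uniform_bv_inverse[OF weight_bv, where c = "c / 2" and N = N1]) auto
  hence q: "uniform_bigo K 0 q" "uniform_bigo K \<sigma> (\<lambda>n p. q (Suc n) p - q n p)" by (simp_all add: uniform_bv_def)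
  obtain C3 N3 where C3: "C3 > 0" "N3 \<ge> 1" "\<And>n p. n \<ge> N3 \<Longrightarrow> p \<in> K \<Longrightarrow> norm (q n p) \<le> C3 * real n powr - 0"
    by (rule uniform_bigoE[OF q(1)]) blast
  obtain C4 N4 where C4: "C4 > 0" "N4 \<ge> 1" "\<And>n p. n \<ge> N4 \<Longrightarrow> p \<in> K \<Longrightarrow>
      norm (q (Suc n) p - q n p) \<le> C4 * real n powr (- \<sigma>)"
    by (rule uniform_bigoE[OF q(2)]) blast
  obtain C5 N5 where C5: "C5 > 0" "N5 \<ge> 1" "\<And>n p. n \<ge> N5 \<Longrightarrow> p \<in> K \<Longrightarrow>
      norm (residual n p / (of_real (real n powr \<sigma>) * approx n p)) \<le> C5 * real n powr (- (\<sigma> + 1 / 2))"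
    by (rule uniform_bigoE[OF residual_bound]) blast
  define d where "d = (\<lambda>n. C4 * real n powr (- \<sigma>))"
  have d: "\<And>k. d k \<ge> 0" "summable d"
    using C4(1) \<sigma> by (auto simp: d_def summable_real_powr_iff intro!: summable_mult)
  define D where "D = 2 * C3 + suminf d"
  have D: "D \<ge> 0" using C3(1) d by (simp add: D_def suminf_nonneg)
  define N where "N = Max {N1, N2, N3, N4, N5, 1}"
  have N: "N1 \<le> N" "N2 \<le> N" "N3 \<le> N" "N4 \<le> N" "N5 \<le> N" "1 \<le> N" by (auto simp: N_def)
  show thesis
  proof (rule that[of "C5 * D" N])
    fix n m p assume nm: "N \<le> n" "n < m" and p: "p \<in> K"
    have X_mono: "norm (X k p) \<le> norm (X (Suc k) p)" if "N \<le> k" for k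
      using N2[of "Suc k" p] p that N by (simp add: X_def phase_Suc)
    have "norm (\<Sum>k\<in>{n..<m}. q k p * (X (Suc k) p - X k p)) \<le> D * norm (X m p)"
      unfolding D_def
    proof (rule abel_summation_bound[where N = N and X = "\<lambda>k. X k p" and q = "\<lambda>k. q k p", OF X_mono])
      fix k assume k: "N \<le> k"
      show "norm (q k p) \<le> C3" using C3(3)[of k p] C3(2) k N p by simp
      show "norm (q (Suc k) p - q k p) \<le> d k" using C4(3)[of k p] k N p by (simp add: d_def)
    qed (use d nm in auto)
    also have "(\<Sum>k\<in>{n..<m}. q k p * (X (Suc k) p - X k p))
        = (\<Sum>k\<in>{n..<m}. 1 / (of_real (a k) * approx k p * approx (Suc k) p))"
    proof (intro sum.cong refl)
      fix k assume k: "k \<in> {n..<m}"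
      have "weight k p \<noteq> 0" using N1[of k p] k nm N p c_pos by auto
      hence "sin (\<theta> (Suc k) p) \<noteq> 0" by (auto simp: weight_def)
      thus "q k p * (X (Suc k) p - X k p) = 1 / (of_real (a k) * approx k p * approx (Suc k) p)"
        using reciprocal_Wronskian_weight[of k p] k nm N by (simp add: q_def)
    qed
    finally have sum: "norm (\<Sum>k\<in>{n..<m}. 1 / (of_real (a k) * approx k p * approx (Suc k) p)) \<le> D * norm (X m p)" .
    have m: "m \<ge> 1" "m \<ge> N5" using nm N by auto
    have "norm (residual m p) \<le> C5 * real m powr (- (\<sigma> + 1 / 2)) * (real m powr \<sigma> * norm (approx m p))"
      using C5(3)[OF m(2) p] m approx_nonzero[of m p] by (simp add: norm_divide norm_mult divide_simps split: if_splits)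
    hence "norm (residual m p * approx m p * (\<Sum>k\<in>{n..<m}. 1 / (of_real (a k) * approx k p * approx (Suc k) p)))
        \<le> (C5 * real m powr (- (\<sigma> + 1 / 2)) * (real m powr \<sigma> * norm (approx m p))) * norm (approx m p) * (D * norm (X m p))"
      unfolding norm_mult using C5(1) D by (intro mult_mono sum) auto
    also have "\<dots> = C5 * D * (real m powr (- (\<sigma> + 1 / 2)) * real m powr \<sigma>) * (norm (approx m p) ^ 2 * norm (X m p))"
      by (simp add: power2_eq_square)
    also have "norm (approx m p) ^ 2 * norm (X m p) = real m powr (- \<rho>) * real m powr (- \<rho>)"
    proof -
      have "norm (approx m p) = real m powr (- \<rho>) * exp (- Im (phase m p))"
        using \<gamma>_abs by (simp add: approx_def ansatz_def norm_mult norm_power)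
      moreover have "norm (X m p) = exp (2 * Im (phase m p))" by (simp add: X_def)
      moreover have "exp (- Im (phase m p)) ^ 2 * exp (2 * Im (phase m p)) = 1"
        by (simp flip: exp_add exp_of_nat_mult)
      ultimately show ?thesis by (simp add: power_mult_distrib power2_eq_square[of "real m powr _"])
    qed
    also have "C5 * D * (real m powr (- (\<sigma> + 1 / 2)) * real m powr \<sigma>) * (real m powr (- \<rho>) * real m powr (- \<rho>))
        = C5 * D * real m powr (- \<sigma>)"
    proof -
      have "real m powr (- (\<sigma> + 1 / 2)) * real m powr \<sigma> * (real m powr (- \<rho>) * real m powr (- \<rho>)) = real m powr (- \<sigma>)"
        unfolding powr_add[symmetric] by (simp add: \<rho>)
      thus ?thesis by (simp add: mult.assoc)
    qed
    finally show "norm (residual m p * approx m p * (\<Sum>k\<in>{n..<m}. 1 / (of_real (a k) * approx k p * approx (Suc k) p)))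
         \<le> C5 * D * real m powr (- \<sigma>)" .
  qed (use C5(1) D N in auto)
qed

text \<open>
  The set \<open>K\<close> does not occur in the limit of the truncated solutions, so the solutions obtained for
  different \<open>K\<close> agree without any uniqueness argument.
\<close>

lemma phase_solution:
  defines "T \<equiv> \<lambda>n M p. truncated_solution a b (\<zeta> p) (\<lambda>n. approx n p) M n"
  shows "uniformly_convergent_on K (T n)"
    and "p \<in> K \<Longrightarrow> jacobi_solution a b (\<zeta> p) (\<lambda>n. lim (\<lambda>M. T n M p))"
    and "asymptotic_uniformly_on K (\<lambda>n p. lim (\<lambda>M. T n M p)) approx"
proof -
  obtain C N where C: "C \<ge> 0" "N \<ge> 1"
    "\<And>n m p. N \<le> n \<Longrightarrow> n < m \<Longrightarrow> p \<in> K \<Longrightarrow>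
       norm (residual m p * approx m p * (\<Sum>k\<in>{n..<m}. 1 / (of_real (a k) * approx k p * approx (Suc k) p)))
         \<le> C * real m powr (- \<sigma>)"
    by (rule kernel_bound) blast
  have g: "summable (\<lambda>m. C * real m powr (- \<sigma>))" "\<And>m. C * real m powr (- \<sigma>) \<ge> 0"
    using C(1) \<sigma> by (auto simp: summable_real_powr_iff intro!: summable_mult)
  have A_bd: "\<exists>B. \<forall>p\<in>K. norm (approx n p) \<le> B" for n
  proof -
    obtain B where B: "\<And>m p. p \<in> K \<Longrightarrow> norm (\<theta> m p) \<le> B m" using \<theta>_bound by metis
    have "norm (approx n p) \<le> real n powr (- \<rho>) * exp (\<Sum>m=1..n. B m)" if "p \<in> K" for p
    proof -
      have "norm (exp (\<i> * phase n p)) \<le> exp (norm (\<i> * phase n p))" by (rule norm_exp)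
      also have "norm (\<i> * phase n p) \<le> (\<Sum>m=1..n. B m)"
        unfolding phase_def using B that by (auto simp: norm_mult intro!: sum_norm_le)
      finally show ?thesis using \<gamma>_abs by (simp add: approx_def ansatz_def norm_mult norm_power mult_left_mono del: norm_exp_eq_Re)
    qed
    thus ?thesis by blast
  qed
  have ker: "norm ((of_real (a (m - 1)) * approx (m - 1) p + (of_real (b m) - \<zeta> p) * approx m p + of_real (a m) * approx (m + 1) p)
      * approx m p * (\<Sum>k\<in>{n..<m}. 1 / (of_real (a k) * approx k p * approx (Suc k) p))) \<le> C * real m powr (- \<sigma>)"
    if "N \<le> n" "n < m" "p \<in> K" for n m p
    using C(3)[OF that] unfolding residual_def .
  note limit = truncated_solution_limit[where a = a and A = approx and K = K and \<zeta> = \<zeta> and R = R and b = b,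
      OF a_pos approx_nonzero A_bd \<zeta>_bound g ker]
  show "uniformly_convergent_on K (T n)" unfolding T_def by (rule limit(1))
  show "p \<in> K \<Longrightarrow> jacobi_solution a b (\<zeta> p) (\<lambda>n. lim (\<lambda>M. T n M p))" unfolding T_def by (rule limit(2))
  show "asymptotic_uniformly_on K (\<lambda>n p. lim (\<lambda>M. T n M p)) approx" unfolding T_def by (rule limit(3))
qed

end

section \<open>Regularity of the limit in the spectral parameter\<close>

lemma continuous_on_truncated_solution:
  assumes "\<And>n. a n > 0" "\<And>n. continuous_on S (A n)" "continuous_on S \<zeta>"
  shows "continuous_on S (\<lambda>p. truncated_solution a b (\<zeta> p) (\<lambda>n. A n p) M n)"
proof (induction "M - n" arbitrary: n rule: less_induct)
  case less
  show ?case
  proof (cases "M \<le> n")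
    case True
    thus ?thesis using assms(2) by (simp add: truncated_solution_eq_anchor)
  next
    case False
    have "a n \<noteq> 0" using assms(1)[of n] by simp
    thus ?thesis using False
      by (subst truncated_solution.simps) (auto intro!: continuous_intros less assms(3))
  qed
qed

lemma holomorphic_on_truncated_solution:
  assumes "\<And>n. a n > 0" "\<And>n. A n holomorphic_on S" "\<zeta> holomorphic_on S"
  shows "(\<lambda>z. truncated_solution a b (\<zeta> z) (\<lambda>n. A n z) M n) holomorphic_on S"
proof (induction "M - n" arbitrary: n rule: less_induct)
  case less
  show ?case
  proof (cases "M \<le> n")
    case True
    thus ?thesis using assms(2) by (simp add: truncated_solution_eq_anchor)
  next
    case False
    have "a n \<noteq> 0" using assms(1)[of n] by simp
    thus ?thesis using False
      by (subst truncated_solution.simps) (auto intro!: holomorphic_intros less assms(3))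
  qed
qed

section \<open>Square roots continued up to the cut\<close>

lemma branch_sqrt_square: "branch_sqrt t ^ 2 = t"
  by (simp add: branch_sqrt_def power_mult_distrib)

lemma Im_branch_sqrt_nonneg: "0 \<le> Im (branch_sqrt t)"
  using Re_csqrt[of "- t"] by (simp add: branch_sqrt_def del: csqrt.simps)

lemma branch_sqrt_cut_square: "branch_sqrt_cut p ^ 2 = snd p"
proof (cases "snd p \<in> \<real>\<^sub>\<ge>\<^sub>0")
  case True
  hence "snd p = of_real (Re (snd p))" "0 \<le> Re (snd p)"
    by (auto simp: complex_nonneg_Reals_iff complex_eq_iff)
  moreover have "(of_real (sqrt (Re (snd p))) :: complex) ^ 2 = of_real (Re (snd p))"
    using calculation(2) by (metis of_real_power real_sqrt_pow2)
  ultimately show ?thesis using True by (simp add: branch_sqrt_cut_def power_mult_distrib)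
qed (simp add: branch_sqrt_cut_def branch_sqrt_square)

lemma Im_branch_sqrt_cut_nonneg: "0 \<le> Im (branch_sqrt_cut p)"
  using Im_branch_sqrt_nonneg by (auto simp: branch_sqrt_cut_def)

text \<open>
  The real part of the square root does not change sign within one half-plane; this excludes
  cancellation when square roots of neighbouring points are added.
\<close>

lemma Re_branch_sqrt_cut:
  assumes "p \<in> closed_cut_plane"
  shows "if fst p then 0 \<le> Re (branch_sqrt_cut p) else Re (branch_sqrt_cut p) \<le> 0"
proof (cases p)
  case (Pair s t)
  show ?thesis
  proof (cases s)
    case True
    thus ?thesis using assms branch_sqrt_cut_upper[of t] Re_csqrt[of t]
      by (simp add: Pair closed_cut_plane_def del: csqrt.simps)
  next
    case False
    hence t: "Im t \<le> 0" using assms by (simp add: Pair closed_cut_plane_def)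
    have "branch_sqrt_cut (False, t) = \<i> * branch_sqrt_cut (True, - t)"
      using t branch_sqrt_cut_lower[OF t] branch_sqrt_cut_upper[of "- t"] by (simp add: branch_sqrt_def)
    thus ?thesis using False Im_branch_sqrt_cut_nonneg[of "(True, - t)"] by (simp add: Pair)
  qed
qed

lemma cut_mult_closed_cut_plane:
  "\<gamma> \<in> {1, - 1} \<Longrightarrow> p \<in> closed_cut_plane \<Longrightarrow> cut_mult \<gamma> p \<in> closed_cut_plane"
  by (auto simp: cut_mult_def closed_cut_plane_def split: if_splits)

lemma t_seq_closed_cut_plane:
  "p \<in> closed_cut_plane \<Longrightarrow> (fst p, t_seq \<sigma> \<tau> n (snd p)) \<in> closed_cut_plane"
proof -
  have "Im (t_seq \<sigma> \<tau> n z) = Im z * real n powr (- \<sigma>)" for z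
    by (simp add: t_seq_def Im_divide_of_nat)
  thus "p \<in> closed_cut_plane \<Longrightarrow> ?thesis"
    by (auto simp: closed_cut_plane_def mult_nonpos_nonneg split: if_splits)
qed

lemma of_nat_mult_t_seq:
  "n \<ge> 1 \<Longrightarrow> of_nat n * t_seq \<sigma> \<tau> n z = - of_real \<tau> + z * of_real (real n powr (1 - \<sigma>))"
proof -
  assume n: "n \<ge> 1"
  have "real n powr (1 - \<sigma>) = real n * real n powr (- \<sigma>)"
    using n powr_add[of "real n" 1 "- \<sigma>"] by simp
  thus ?thesis using n by (simp add: t_seq_def algebra_simps)
qed

lemma continuous_on_cut_mult: "\<gamma> \<in> {1, - 1} \<Longrightarrow> continuous_on closed_cut_plane (cut_mult \<gamma>)"
  unfolding continuous_on_closed_cut_plane_iff cut_mult_def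
  by (auto intro!: continuous_intros)

lemma continuous_on_theta_cut:
  assumes "\<gamma> \<in> {1, - 1}"
  shows "continuous_on closed_cut_plane (\<lambda>p. theta_cut \<sigma> \<tau> n (cut_mult \<gamma> p))"
  unfolding theta_cut_def
proof (rule continuous_on_compose2[OF continuous_on_branch_sqrt_cut])
  show "continuous_on closed_cut_plane (\<lambda>p. (fst (cut_mult \<gamma> p), t_seq \<sigma> \<tau> n (snd (cut_mult \<gamma> p))))"
    unfolding t_seq_def by (intro continuous_intros continuous_on_cut_mult assms)
qed (use t_seq_closed_cut_plane cut_mult_closed_cut_plane[OF assms] in blast)

lemma holomorphic_on_theta_cut:
  assumes "\<gamma> \<in> {1, - 1}" "n \<ge> 1"
  shows "(\<lambda>z. theta_cut \<sigma> \<tau> n (cut_mult \<gamma> (0 < Im z, z))) holomorphic_on {z. Im z \<noteq> 0}"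
proof -
  let ?t = "\<lambda>z. t_seq \<sigma> \<tau> n (of_real \<gamma> * z)"
  have "Im (?t z) \<noteq> 0" if "Im z \<noteq> 0" for z
    using that assms by (auto simp: t_seq_def Im_divide_of_nat)
  hence t: "?t z \<in> - \<real>\<^sub>\<ge>\<^sub>0" if "Im z \<noteq> 0" for z
    using that by (auto simp: complex_nonneg_Reals_iff)
  have "?t holomorphic_on {z. Im z \<noteq> 0}" unfolding t_seq_def by (intro holomorphic_intros)
  hence "(branch_sqrt \<circ> ?t) holomorphic_on {z. Im z \<noteq> 0}"
    by (rule holomorphic_on_compose_gen[OF _ holomorphic_branch_sqrt]) (use t in blast)
  thus ?thesis
  proof (rule holomorphic_transform)
    fix z assume "z \<in> {z. Im z \<noteq> 0}"
    thus "(branch_sqrt \<circ> ?t) z = theta_cut \<sigma> \<tau> n (cut_mult \<gamma> (0 < Im z, z))"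
      using t[of z] by (simp add: theta_cut_def branch_sqrt_cut_def cut_mult_def)
  qed
qed

section \<open>The solution up to the cut\<close>

context critical_jacobi
begin

lemma uniform_bigo_spectral_term:
  assumes "\<And>p. p \<in> K \<Longrightarrow> norm (\<zeta> p) \<le> R"
  shows "uniform_bigo K (\<sigma> - 1) (\<lambda>n p. \<zeta> p * of_real (real n powr (1 - \<sigma>)))"
    and "uniform_bigo K \<sigma> (\<lambda>n p. \<zeta> p * of_real (real (Suc n) powr (1 - \<sigma>)) - \<zeta> p * of_real (real n powr (1 - \<sigma>)))"
proof -
  note z = uniform_bigo_bounded[of K \<zeta> R, OF assms]
  have "uniform_bigo K (\<sigma> - 1) (\<lambda>n (p::'a). of_real (real n powr (1 - \<sigma>)))"
    by (rule uniform_bigo_of_real) simp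
  thus "uniform_bigo K (\<sigma> - 1) (\<lambda>n p. \<zeta> p * of_real (real n powr (1 - \<sigma>)))"
    by (intro uniform_bigo_mult[OF z]) auto
  have "(\<lambda>n. (real n + 1) powr (1 - \<sigma>) - real n powr (1 - \<sigma>)) \<in> O(\<lambda>n. real n powr (- \<sigma>))"
    using \<sigma>(1) by real_asymp
  hence "uniform_bigo K \<sigma> (\<lambda>n (p::'a). of_real ((real n + 1) powr (1 - \<sigma>) - real n powr (1 - \<sigma>)))"
    by (rule uniform_bigo_of_real)
  hence "uniform_bigo K \<sigma> (\<lambda>n p. \<zeta> p * of_real ((real n + 1) powr (1 - \<sigma>) - real n powr (1 - \<sigma>)))"
    by (intro uniform_bigo_mult[OF z]) auto
  thus "uniform_bigo K \<sigma> (\<lambda>n p. \<zeta> p * of_real (real (Suc n) powr (1 - \<sigma>)) - \<zeta> p * of_real (real n powr (1 - \<sigma>)))"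
    by (simp add: algebra_simps)
qed

text \<open>
  For \<open>\<tau> < 0\<close> the numbers \<open>n t\<^sub>n\<close> tend to \<open>- \<tau> > 0\<close>, so that \<open>n\<^sup>1\<^sup>/\<^sup>2 \<theta>\<^sub>n\<close> stays near one of the two
  real roots of \<open>- \<tau>\<close>, which one depending only on the half-plane.
\<close>

lemma cut_phase_admissible:
  assumes \<tau>_neg: "\<tau> < 0" and K: "K \<subseteq> closed_cut_plane" "\<And>p. p \<in> K \<Longrightarrow> norm (snd p) \<le> R"
  shows "admissible_phase a b ra rb \<gamma> \<sigma> \<alpha> \<beta> \<tau> \<rho> K snd (\<lambda>n p. theta_cut \<sigma> \<tau> n (cut_mult \<gamma> p)) R (sqrt (- \<tau> / 2))"
proof -
  define \<theta> where "\<theta> = (\<lambda>n p. theta_cut \<sigma> \<tau> n (cut_mult \<gamma> p))"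
  define \<psi> where "\<psi> = (\<lambda>n p. of_real (sqrt (real n)) * \<theta> n p)"
  define w where "w = (\<lambda>p :: bool \<times> complex. of_real \<gamma> * snd p)"
  define y where "y = (\<lambda>n p. - of_real \<tau> + w p * of_real (real n powr (1 - \<sigma>)))"
  have w: "norm (w p) \<le> R" if "p \<in> K" for p using K(2)[OF that] \<gamma>_abs by (simp add: w_def norm_mult)
  have \<theta>_sq: "\<theta> n p ^ 2 = t_seq \<sigma> \<tau> n (w p)" for n p
    by (simp add: \<theta>_def theta_cut_def branch_sqrt_cut_square w_def cut_mult_def)
  have \<psi>_sq: "\<psi> n p ^ 2 = y n p" if "n \<ge> 1" for n p
  proof -
    have "(of_real (sqrt (real n)) :: complex) ^ 2 = of_nat n"
      by (metis of_real_power of_nat_0_le_iff of_real_of_nat_eq real_sqrt_pow2)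
    thus ?thesis unfolding \<psi>_def power_mult_distrib \<theta>_sq using of_nat_mult_t_seq[OF that] by (simp add: y_def)
  qed
  define c where "c = sqrt (- \<tau> / 2)"
  have c: "c > 0" "c ^ 2 = - \<tau> / 2" using \<tau>_neg by (auto simp: c_def)
  have "\<forall>\<^sub>F n in sequentially. \<forall>p\<in>K. norm (w p * of_real (real n powr (1 - \<sigma>))) < - \<tau> / 2"
    by (rule uniform_bigo_eventually_small[OF uniform_bigo_spectral_term(1)[OF w]]) (use \<sigma> \<tau>_neg in auto)
  then obtain N where N: "\<And>n p. n \<ge> N \<Longrightarrow> p \<in> K \<Longrightarrow> norm (w p * of_real (real n powr (1 - \<sigma>))) < - \<tau> / 2"
    by (auto simp: eventually_sequentially)
  have y_bounds: "norm (y n p) \<le> - 2 * \<tau>" "- \<tau> / 2 \<le> Re (y n p)" if "n \<ge> N" "p \<in> K" for n p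
  proof -
    let ?e = "w p * of_real (real n powr (1 - \<sigma>))"
    show "norm (y n p) \<le> - 2 * \<tau>"
      using norm_triangle_ineq[of "- of_real \<tau>" ?e] N[OF that] \<tau>_neg by (simp add: y_def)
    show "- \<tau> / 2 \<le> Re (y n p)"
      using abs_Re_le_cmod[of ?e] N[OF that] unfolding y_def by simp
  qed
  have Re_\<psi>: "c \<le> \<bar>Re (\<psi> n p)\<bar>" if "n \<ge> max N 1" "p \<in> K" for n p
  proof -
    have "Re (y n p) = Re (\<psi> n p) ^ 2 - Im (\<psi> n p) ^ 2"
      using \<psi>_sq[of n p] that by (simp flip: Re_power2)
    moreover have "- \<tau> / 2 \<le> Re (y n p)" using y_bounds(2)[of n p] that by simp
    ultimately have "c ^ 2 \<le> \<bar>Re (\<psi> n p)\<bar> ^ 2"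
      using c(2) zero_le_power2[of "Im (\<psi> n p)"] unfolding power2_abs by linarith
    thus ?thesis by (rule power2_le_imp_le) simp
  qed
  have sign: "if fst (cut_mult \<gamma> p) then 0 \<le> Re (\<psi> n p) else Re (\<psi> n p) \<le> 0" if "p \<in> K" for n p
  proof -
    have "(fst (cut_mult \<gamma> p), t_seq \<sigma> \<tau> n (snd (cut_mult \<gamma> p))) \<in> closed_cut_plane"
      using K(1) that cut_mult_closed_cut_plane[OF \<gamma>] t_seq_closed_cut_plane by blast
    from Re_branch_sqrt_cut[OF this] show ?thesis
      by (auto simp: \<psi>_def \<theta>_def theta_cut_def mult_nonneg_nonpos split: if_splits)
  qed
  have "admissible_phase a b ra rb \<gamma> \<sigma> \<alpha> \<beta> \<tau> \<rho> K snd \<theta> R c"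
  proof (unfold_locales)
    fix n
    have "norm (\<theta> n p) \<le> sqrt (\<bar>\<tau>\<bar> / real n + R * real n powr (- \<sigma>))" if "p \<in> K" for p
    proof (rule real_le_rsqrt)
      have "norm (\<theta> n p) ^ 2 = norm (t_seq \<sigma> \<tau> n (w p))" by (simp flip: norm_power \<theta>_sq)
      also have "\<dots> \<le> norm (- of_real \<tau> / of_nat n :: complex) + norm (w p * of_real (real n powr (- \<sigma>)))"
        unfolding t_seq_def by (rule norm_triangle_ineq)
      also have "\<dots> \<le> \<bar>\<tau>\<bar> / real n + R * real n powr (- \<sigma>)"
        using w[OF that] by (simp add: norm_mult norm_divide mult_right_mono)
      finally show "norm (\<theta> n p) ^ 2 \<le> \<bar>\<tau>\<bar> / real n + R * real n powr (- \<sigma>)" .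
    qed
    thus "\<exists>B. \<forall>p\<in>K. norm (\<theta> n p) \<le> B" by blast
  next
    show "uniform_bigo K (1 / 2) \<theta>"
    proof (rule uniform_bigoI[of "max N 1" _ _ "sqrt (- 2 * \<tau>)"])
      fix n p assume np: "max N 1 \<le> n" "p \<in> K"
      have "norm (\<psi> n p) ^ 2 = norm (y n p)" using np \<psi>_sq[of n p] by (simp flip: norm_power)
      hence "norm (\<psi> n p) \<le> sqrt (- 2 * \<tau>)" using y_bounds(1)[of n p] np by (intro real_le_rsqrt) simp
      hence "sqrt (real n) * norm (\<theta> n p) \<le> sqrt (- 2 * \<tau>)" by (simp add: \<psi>_def norm_mult)
      thus "norm (\<theta> n p) \<le> sqrt (- 2 * \<tau>) * real n powr - (1 / 2)"
        using np by (simp add: powr_minus powr_half_sqrt field_simps)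
    qed
  next
    show "c > 0" by (rule c(1))
    have "\<forall>p\<in>K. c \<le> norm (of_real (sqrt (real n)) * \<theta> n p)" if "n \<ge> max N 1" for n
      using Re_\<psi>[OF that] abs_Re_le_cmod order.trans unfolding \<psi>_def by blast
    thus "\<forall>\<^sub>F n in sequentially. \<forall>p\<in>K. c \<le> norm (of_real (sqrt (real n)) * \<theta> n p)"
      unfolding eventually_sequentially by blast
  next
    have "uniform_bigo K \<sigma> (\<lambda>n p. y (Suc n) p - y n p)"
      using uniform_bigo_spectral_term(2)[of K w, OF w] by (simp add: y_def)
    then obtain C N' where C: "C > 0" "\<And>n p. n \<ge> N' \<Longrightarrow> p \<in> K \<Longrightarrow> norm (y (Suc n) p - y n p) \<le> C * real n powr (- \<sigma>)"
      by (rule uniform_bigoE) blast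
    show "uniform_bigo K \<sigma> (\<lambda>n p. of_real (sqrt (real (Suc n))) * \<theta> (Suc n) p - of_real (sqrt (real n)) * \<theta> n p)"
    proof (rule uniform_bigoI[of "Max {N, N', 1}" _ _ "C / c"])
      fix n p assume n: "Max {N, N', 1} \<le> n" and p: "p \<in> K"
      have n': "n \<ge> max N 1" "n \<ge> N'" using n by auto
      have "c \<le> \<bar>Re (\<psi> (Suc n) p + \<psi> n p)\<bar>"
        using Re_\<psi>[OF n'(1) p] sign[OF p, of n] sign[OF p, of "Suc n"] by (auto split: if_splits)
      hence lower: "c \<le> norm (\<psi> (Suc n) p + \<psi> n p)" using abs_Re_le_cmod order.trans by blast
      have "(\<psi> (Suc n) p - \<psi> n p) * (\<psi> (Suc n) p + \<psi> n p) = y (Suc n) p - y n p"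
        using \<psi>_sq[of n p] \<psi>_sq[of "Suc n" p] n' by (simp add: algebra_simps power2_eq_square)
      hence "norm (\<psi> (Suc n) p - \<psi> n p) * norm (\<psi> (Suc n) p + \<psi> n p) \<le> C * real n powr (- \<sigma>)"
        using C(2)[OF n'(2) p] by (simp flip: norm_mult)
      moreover have "norm (\<psi> (Suc n) p - \<psi> n p) * c \<le> norm (\<psi> (Suc n) p - \<psi> n p) * norm (\<psi> (Suc n) p + \<psi> n p)"
        using lower by (rule mult_left_mono) simp
      ultimately have "norm (\<psi> (Suc n) p - \<psi> n p) * c \<le> C * real n powr (- \<sigma>)" by linarith
      thus "norm (of_real (sqrt (real (Suc n))) * \<theta> (Suc n) p - of_real (sqrt (real n)) * \<theta> n p)
          \<le> C / c * real n powr (- \<sigma>)"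
        using c(1) unfolding \<psi>_def by (simp add: field_simps)
    qed
  next
    show "uniform_bigo K (\<sigma> + 1 / 2) (\<lambda>n p. \<theta> n p ^ 2 - t_seq \<sigma> \<tau> n (of_real \<gamma> * snd p))"
      by (rule uniform_bigoI[of 0 _ _ 0]) (simp add: \<theta>_sq w_def)
    show "\<forall>\<^sub>F n in sequentially. \<forall>p\<in>K. 0 \<le> Im (\<theta> n p)"
      by (simp add: \<theta>_def theta_cut_def Im_branch_sqrt_cut_nonneg)
  qed (use K(2) in auto)
  thus ?thesis unfolding \<theta>_def c_def .
qed

text \<open>
  The parts of the closed half-planes in a disc are admissible, the rank from which on the estimates
  hold depending on the radius.  The convergence of the truncated solutions is thus locally
  uniform, including the edges of the cut.
\<close>

theorem solution_up_to_cut: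
  assumes \<tau>_neg: "\<tau> < 0"
  defines "f \<equiv> \<lambda>n p. lim (\<lambda>M. truncated_solution a b (snd p)
      (\<lambda>n. ansatz \<gamma> \<rho> n (\<Sum>m=1..n. theta_cut \<sigma> \<tau> m (cut_mult \<gamma> p))) M n)"
  shows "p \<in> closed_cut_plane \<Longrightarrow> jacobi_solution a b (snd p) (\<lambda>n. f n p)"
    and "analytic_continuous_up_to_cut (f n)"
    and "compact K \<Longrightarrow> K \<subseteq> closed_cut_plane \<Longrightarrow> asymptotic_uniformly_on K f
               (\<lambda>n p. ansatz \<gamma> \<rho> n (\<Sum>m=1..n. theta_cut \<sigma> \<tau> m (cut_mult \<gamma> p)))"
proof -
  define \<theta> where "\<theta> = (\<lambda>n p. theta_cut \<sigma> \<tau> n (cut_mult \<gamma> p))"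
  define A where "A = (\<lambda>n p. ansatz \<gamma> \<rho> n (\<Sum>m=1..n. \<theta> m p))"
  define T where "T = (\<lambda>n M p. truncated_solution a b (snd p) (\<lambda>n. A n p) M n)"
  have f: "f = (\<lambda>n p. lim (\<lambda>M. T n M p))" by (simp add: f_def T_def A_def \<theta>_def fun_eq_iff)
  have main: "uniform_limit K (T n) (f n) sequentially" "\<forall>p\<in>K. jacobi_solution a b (snd p) (\<lambda>n. f n p)"
      "asymptotic_uniformly_on K f A"
    if "K \<subseteq> closed_cut_plane" "\<And>p. p \<in> K \<Longrightarrow> norm (snd p) \<le> R" for K R n
  proof -
    interpret admissible_phase a b ra rb \<gamma> \<sigma> \<alpha> \<beta> \<tau> \<rho> K snd \<theta> R "sqrt (- \<tau> / 2)"
      unfolding \<theta>_def by (rule cut_phase_admissible[OF \<tau>_neg that])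
    have A'': "A = approx" by (simp add: fun_eq_iff A_def approx_def phase_def)
    show "uniform_limit K (T n) (f n) sequentially"
      using phase_solution(1)[of n] unfolding f T_def A'' uniformly_convergent_uniform_limit_iff .
    show "\<forall>p\<in>K. jacobi_solution a b (snd p) (\<lambda>n. f n p)" "asymptotic_uniformly_on K f A"
      using phase_solution(2,3) unfolding f T_def A'' by blast+
  qed
  show "p \<in> closed_cut_plane \<Longrightarrow> jacobi_solution a b (snd p) (\<lambda>n. f n p)"
    using main(2)[of "{p}" "norm (snd p)"] by simp
  show "asymptotic_uniformly_on K f (\<lambda>n p. ansatz \<gamma> \<rho> n (\<Sum>m=1..n. theta_cut \<sigma> \<tau> m (cut_mult \<gamma> p)))"
    if K: "compact K" "K \<subseteq> closed_cut_plane" for K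
  proof -
    have "bounded (snd ` K)" using K(1) by (intro compact_imp_bounded compact_continuous_image continuous_intros)
    then obtain R where "\<And>p. p \<in> K \<Longrightarrow> norm (snd p) \<le> R" unfolding bounded_iff by auto
    from main(3)[OF K(2) this] show ?thesis unfolding A_def \<theta>_def .
  qed
  have A_cont: "continuous_on closed_cut_plane (A n)" for n
    unfolding A_def ansatz_def \<theta>_def by (intro continuous_intros continuous_on_theta_cut \<gamma>)
  have T_cont: "continuous_on closed_cut_plane (T n M)" for n M
    unfolding T_def by (intro continuous_on_truncated_solution a_pos A_cont continuous_intros)
  have "continuous_on closed_cut_plane (f n)"
    unfolding continuous_on_eq_continuous_within
  proof
    fix p assume p: "p \<in> closed_cut_plane"
    let ?B = "{q. norm (snd q) < norm (snd p) + 1} :: (bool \<times> complex) set"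
    have "uniform_limit (closed_cut_plane \<inter> ?B) (T n) (f n) sequentially"
      by (rule main(1)[of _ "norm (snd p) + 1"]) auto
    hence "continuous_on (closed_cut_plane \<inter> ?B) (f n)"
      by (rule uniform_limit_theorem[rotated]) (auto intro!: always_eventually continuous_on_subset[OF T_cont])
    hence "continuous (at p within closed_cut_plane \<inter> ?B) (f n)"
      using p by (simp add: continuous_on_eq_continuous_within)
    moreover have "open ?B" by (intro open_Collect_less continuous_intros)
    hence "at p within closed_cut_plane \<inter> ?B = at p within closed_cut_plane"
      by (intro at_within_nhd[of p ?B]) auto
    ultimately show "continuous (at p within closed_cut_plane) (f n)" by simp
  qed
  moreover have "(\<lambda>z. f n (0 < Im z, z)) holomorphic_on {z. Im z \<noteq> 0}"
  proof (rule holomorphic_uniform_sequence)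
    show op: "open {z. Im z \<noteq> 0}" by (intro open_Collect_neq continuous_intros)
    have "(\<lambda>z. A n (0 < Im z, z)) holomorphic_on {z. Im z \<noteq> 0}" for n
      unfolding A_def ansatz_def \<theta>_def by (intro holomorphic_intros holomorphic_on_theta_cut \<gamma>) auto
    thus "(\<lambda>z. T n M (0 < Im z, z)) holomorphic_on {z. Im z \<noteq> 0}" for M
      unfolding T_def snd_conv by (intro holomorphic_on_truncated_solution a_pos holomorphic_intros)
    fix z assume "z \<in> {z. Im z \<noteq> 0}"
    then obtain d where d: "d > 0" "cball z d \<subseteq> {z. Im z \<noteq> 0}" using op open_contains_cball by blast
    have "uniform_limit ((\<lambda>z. (0 < Im z, z)) ` cball z d) (T n) (f n) sequentially"
    proof (rule main(1)[of _ "norm z + d"])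
      show "(\<lambda>z. (0 < Im z, z)) ` cball z d \<subseteq> closed_cut_plane" by (auto simp: closed_cut_plane_def)
      fix p assume "p \<in> (\<lambda>z. (0 < Im z, z)) ` cball z d"
      then obtain z' where "p = (0 < Im z', z')" "dist z z' \<le> d" by auto
      thus "norm (snd p) \<le> norm z + d"
        using norm_triangle_ineq2[of z' z] by (simp add: dist_norm norm_minus_commute)
    qed
    hence "uniform_limit (cball z d) (\<lambda>M z. T n M (0 < Im z, z)) (\<lambda>z. f n (0 < Im z, z)) sequentially"
      by (rule uniform_limit_compose') auto
    thus "\<exists>d>0. cball z d \<subseteq> {z. Im z \<noteq> 0} \<and>
        uniform_limit (cball z d) (\<lambda>M z. T n M (0 < Im z, z)) (\<lambda>z. f n (0 < Im z, z)) sequentially"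
      using d by blast
  qed
  ultimately show "analytic_continuous_up_to_cut (f n)"
    by (simp add: analytic_continuous_up_to_cut_def)
qed

end

section \<open>The entire solution\<close>

text \<open>
  The truncations of the binomial series of \<open>(1 - x)\<^sup>1\<^sup>/\<^sup>2\<close>, found by successive correction: a change of
  \<open>q\<close> by \<open>- x\<^sup>k r(0) / 2\<close> removes the leading term of the error \<open>x\<^sup>k r(x)\<close>, up to terms of higher order,
  as \<open>q(0) = 1\<close>.
\<close>

lemma approximate_sqrt_polynomial:
  obtains q :: "complex poly" where "poly q 0 = 1" "[:0, 1:] ^ Suc L dvd q ^ 2 - [:1, - 1:]"
proof -
  have "\<exists>q :: complex poly. poly q 0 = 1 \<and> [:0, 1:] ^ Suc L dvd q ^ 2 - [:1, - 1:]"
  proof (induction L)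
    case 0
    have "1 ^ 2 - [:1, - 1:] = ([:0, 1:] :: complex poly)"
      unfolding power_one by (simp add: one_pCons)
    thus ?case by (intro exI[of _ 1]) auto
  next
    case (Suc L)
    then obtain q r :: "complex poly" where q: "poly q 0 = 1" "q ^ 2 - [:1, - 1:] = [:0, 1:] ^ Suc L * r"
      by (auto elim: dvdE)
    define e where "e = [:poly r 0 / 2:]"
    define x where "x = ([:0, 1:] :: complex poly) ^ Suc L"
    define q' where "q' = q - x * e"
    have x0: "poly x 0 = 0" by (simp add: x_def)
    have "q' ^ 2 - [:1, - 1:] = (q ^ 2 - [:1, - 1:]) + x * (x * e ^ 2 - 2 * e * q)"
      by (simp add: q'_def power2_eq_square algebra_simps)
    also have "\<dots> = x * (r + x * e ^ 2 - 2 * e * q)"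
      unfolding q(2) x_def[symmetric] by (simp add: algebra_simps)
    finally have eq: "q' ^ 2 - [:1, - 1:] = x * (r + x * e ^ 2 - 2 * e * q)" .
    have "poly (r + x * e ^ 2 - 2 * e * q) 0 = 0" using q(1) by (simp add: x0 e_def)
    hence "[:0, 1:] dvd r + x * e ^ 2 - 2 * e * q" using poly_eq_0_iff_dvd[of "r + x * e ^ 2 - 2 * e * q" 0] by simp
    hence "[:0, 1:] ^ Suc (Suc L) dvd q' ^ 2 - [:1, - 1:]"
      unfolding eq x_def by (subst power_Suc2) (rule mult_dvd_mono[OF dvd_refl])
    moreover have "poly q' 0 = 1" by (simp add: q'_def x0 q(1))
    ultimately show ?case by blast
  qed
  thus thesis using that by blast
qed

lemma asymptotic_uniformly_on_subset:
  assumes "asymptotic_uniformly_on K f g" "K' \<subseteq> K"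
  shows "asymptotic_uniformly_on K' f g"
proof -
  obtain \<epsilon> where \<epsilon>: "uniform_limit K \<epsilon> (\<lambda>_. 0) sequentially"
    "\<forall>\<^sub>F n in sequentially. \<forall>p\<in>K. f n p = g n p * (1 + \<epsilon> n p)"
    using assms(1) unfolding asymptotic_uniformly_on_def by blast
  have "\<forall>\<^sub>F n in sequentially. \<forall>p\<in>K'. f n p = g n p * (1 + \<epsilon> n p)"
    using \<epsilon>(2) by eventually_elim (use assms(2) in blast)
  thus ?thesis
    unfolding asymptotic_uniformly_on_def using uniform_limit_on_subset[OF \<epsilon>(1) assms(2)] by blast
qed

text \<open>A null sequence may be dropped from the exponent of the asymptotic form.\<close>

lemma asymptotic_uniformly_on_exp_null:
  assumes f: "asymptotic_uniformly_on K f g" and \<delta>: "uniform_limit K \<delta> (\<lambda>_. 0) sequentially"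
    and g: "\<And>n p. n \<ge> N \<Longrightarrow> p \<in> K \<Longrightarrow> g n p = h n p * exp (\<delta> n p)"
  shows "asymptotic_uniformly_on K f h"
proof -
  obtain \<epsilon> where \<epsilon>: "uniform_limit K \<epsilon> (\<lambda>_. 0) sequentially"
    "\<forall>\<^sub>F n in sequentially. \<forall>p\<in>K. f n p = g n p * (1 + \<epsilon> n p)"
    using f unfolding asymptotic_uniformly_on_def by blast
  define \<epsilon>' where "\<epsilon>' = (\<lambda>n p. exp (\<delta> n p) * \<epsilon> n p + (exp (\<delta> n p) - 1))"
  have "uniform_limit K \<epsilon>' (\<lambda>_. 0) sequentially"
  proof (rule uniform_limitI)
    fix e :: real assume e: "e > 0"
    have "isCont (exp :: complex \<Rightarrow> complex) 0" by simp
    then obtain \<eta> where \<eta>: "\<eta> > 0" "\<And>w::complex. norm w < \<eta> \<Longrightarrow> norm (exp w - 1) < min 1 (e / 2)"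
      unfolding continuous_at_eps_delta using e
      by (auto simp: dist_norm dest!: spec[of _ "min 1 (e / 2)"])
    have "\<forall>\<^sub>F n in sequentially. \<forall>p\<in>K. dist (\<delta> n p) 0 < \<eta>" using \<delta> \<eta>(1) by (rule uniform_limitD)
    moreover have "\<forall>\<^sub>F n in sequentially. \<forall>p\<in>K. dist (\<epsilon> n p) 0 < e / 4"
      using e by (intro uniform_limitD[OF \<epsilon>(1)]) simp
    ultimately show "\<forall>\<^sub>F n in sequentially. \<forall>p\<in>K. dist (\<epsilon>' n p) 0 < e"
    proof eventually_elim
      case (elim n)
      show ?case
      proof
        fix p assume p: "p \<in> K"
        have 1: "norm (exp (\<delta> n p) - 1) < 1" "norm (exp (\<delta> n p) - 1) < e / 2"
          using \<eta>(2)[of "\<delta> n p"] elim p by auto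
        hence "norm (exp (\<delta> n p)) \<le> 2" using norm_triangle_ineq2[of "exp (\<delta> n p)" 1] by simp
        hence "norm (exp (\<delta> n p) * \<epsilon> n p) \<le> 2 * (e / 4)"
          unfolding norm_mult using elim p by (intro mult_mono) (auto intro: less_imp_le)
        thus "dist (\<epsilon>' n p) 0 < e"
          using norm_triangle_ineq[of "exp (\<delta> n p) * \<epsilon> n p" "exp (\<delta> n p) - 1"] 1(2) by (simp add: \<epsilon>'_def)
      qed
    qed
  qed
  moreover have "\<forall>\<^sub>F n in sequentially. \<forall>p\<in>K. f n p = h n p * (1 + \<epsilon>' n p)"
    using \<epsilon>(2) eventually_ge_at_top[of N]
    by eventually_elim (simp add: g \<epsilon>'_def algebra_simps)
  ultimately show ?thesis unfolding asymptotic_uniformly_on_def by blast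
qed

text \<open>
  The function \<open>\<i> (\<tau> / n)\<^sup>1\<^sup>/\<^sup>2 q(x)\<close> with \<open>x = \<gamma> z n powr (1 - \<sigma>) / \<tau>\<close>: for \<open>q(x) = (1 - x)\<^sup>1\<^sup>/\<^sup>2\<close> it would be the
  square root of \<open>t\<^sub>n\<close>, for a polynomial \<open>q\<close> it is entire in \<open>z\<close>.
\<close>

definition entire_theta :: "complex poly \<Rightarrow> real \<Rightarrow> real \<Rightarrow> real \<Rightarrow> nat \<Rightarrow> complex \<Rightarrow> complex" where
  "entire_theta q \<gamma> \<sigma> \<tau> n z =
     \<i> * of_real (sqrt (\<tau> / real n)) * poly q (of_real (\<gamma> / \<tau>) * z * of_real (real n powr (1 - \<sigma>)))"

lemma holomorphic_on_entire_theta [holomorphic_intros]: "entire_theta q \<gamma> \<sigma> \<tau> n holomorphic_on S"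
proof -
  have "(\<lambda>z. poly q (h z)) holomorphic_on S" if "h holomorphic_on S" for h
    by (induction q) (simp_all, intro holomorphic_intros that)
  thus ?thesis unfolding entire_theta_def by (intro holomorphic_intros)
qed

context critical_jacobi
begin

context
  fixes q :: "complex poly" and L :: nat and R :: real
  assumes \<tau>_pos: "\<tau> > 0"
    and L: "\<sigma> - 1 / 2 \<le> real (Suc L) * (\<sigma> - 1)"
    and q: "poly q 0 = 1" "[:0, 1:] ^ Suc L dvd q ^ 2 - [:1, - 1:]"
begin

definition argument :: "nat \<Rightarrow> complex \<Rightarrow> complex" where
  "argument n z = of_real (\<gamma> / \<tau>) * z * of_real (real n powr (1 - \<sigma>))"

lemma entire_theta_argument:
  "entire_theta q \<gamma> \<sigma> \<tau> n z = \<i> * of_real (sqrt (\<tau> / real n)) * poly q (argument n z)"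
  by (simp add: entire_theta_def argument_def)

lemma Im_entire_theta:
  "Im (entire_theta q \<gamma> \<sigma> \<tau> n z) = sqrt (\<tau> / real n) * Re (poly q (argument n z))"
  unfolding entire_theta_argument by (simp del: of_real_mult)

lemma argument_order:
  shows argument_bigo: "uniform_bigo (cball 0 R) (\<sigma> - 1) argument"
    and argument_bv: "uniform_bv (cball 0 R) \<sigma> argument"
proof -
  have b: "norm (of_real (\<gamma> / \<tau>) * z) \<le> \<bar>\<gamma> / \<tau>\<bar> * R" if "z \<in> cball 0 R" for z :: complex
    using that by (simp add: norm_mult norm_divide mult_left_mono divide_right_mono)
  note * = uniform_bigo_spectral_term[of "cball 0 R" "\<lambda>z. of_real (\<gamma> / \<tau>) * z", OF b, folded argument_def]
  show 1: "uniform_bigo (cball 0 R) (\<sigma> - 1) argument" by (rule *(1))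
  have "uniform_bigo (cball 0 R) 0 argument" by (rule uniform_bigo_mono[OF 1]) (use \<sigma> in simp)
  thus "uniform_bv (cball 0 R) \<sigma> argument" using *(2) by (simp add: uniform_bv_def)
qed

lemma poly_argument_near_1:
  "\<forall>\<^sub>F n in sequentially. \<forall>z\<in>cball 0 R. 1 / 2 \<le> Re (poly q (argument n z))"
proof -
  obtain k r where kr: "q = pCons k r" by (cases q)
  hence k: "k = 1" using q(1) by simp
  have "uniform_bigo (cball 0 R) 0 (\<lambda>n z. poly r (argument n z))"
    using uniform_bv_poly[OF argument_bv, of r] by (simp add: uniform_bv_def)
  hence "uniform_bigo (cball 0 R) (\<sigma> - 1) (\<lambda>n z. argument n z * poly r (argument n z))"
    by (intro uniform_bigo_mult[OF argument_bigo]) auto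
  hence "\<forall>\<^sub>F n in sequentially. \<forall>z\<in>cball 0 R. norm (argument n z * poly r (argument n z)) < 1 / 2"
    by (rule uniform_bigo_eventually_small) (use \<sigma> in auto)
  thus ?thesis
  proof eventually_elim
    case (elim n)
    show ?case
    proof
      fix z :: complex assume "z \<in> cball 0 R"
      hence "norm (argument n z * poly r (argument n z)) < 1 / 2" using elim by blast
      thus "1 / 2 \<le> Re (poly q (argument n z))"
        using abs_Re_le_cmod[of "argument n z * poly r (argument n z)"] by (simp add: kr k)
    qed
  qed
qed

lemma entire_theta_square:
  "uniform_bigo (cball 0 R) (\<sigma> + 1 / 2) (\<lambda>n z. entire_theta q \<gamma> \<sigma> \<tau> n z ^ 2 - t_seq \<sigma> \<tau> n (of_real \<gamma> * z))"
proof -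
  obtain r where r: "q ^ 2 - [:1, - 1:] = [:0, 1:] ^ Suc L * r" using q(2) by (auto elim: dvdE)
  have r': "poly q x ^ 2 - (1 - x) = x ^ Suc L * poly r x" for x
    using arg_cong[OF r, of "\<lambda>p. poly p x"] by (simp add: algebra_simps)
  have "uniform_bigo (cball 0 R) 0 (\<lambda>n z. poly r (argument n z))"
    using uniform_bv_poly[OF argument_bv, of r] by (simp add: uniform_bv_def)
  hence 1: "uniform_bigo (cball 0 R) (real (Suc L) * (\<sigma> - 1)) (\<lambda>n z. argument n z ^ Suc L * poly r (argument n z))"
    by (intro uniform_bigo_mult[OF uniform_bigo_power[OF argument_bigo refl]]) auto
  have "uniform_bigo (cball 0 R) 1 (\<lambda>n z :: complex. of_real (- \<tau> / real n))"
    by (rule uniform_bigo_of_real) real_asymp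
  hence "uniform_bigo (cball 0 R) (1 + real (Suc L) * (\<sigma> - 1))
      (\<lambda>n z. of_real (- \<tau> / real n) * (argument n z ^ Suc L * poly r (argument n z)))"
    by (rule uniform_bigo_mult[OF _ 1]) simp
  hence "uniform_bigo (cball 0 R) (\<sigma> + 1 / 2)
      (\<lambda>n z. of_real (- \<tau> / real n) * (argument n z ^ Suc L * poly r (argument n z)))"
    by (rule uniform_bigo_mono) (use L in simp)
  thus ?thesis
  proof (rule uniform_bigo_cong[where N = 1])
    fix n :: nat and z :: complex assume n: "n \<ge> 1"
    have "(of_real (sqrt (\<tau> / real n)) :: complex) ^ 2 = of_real (\<tau> / real n)"
      using \<tau>_pos by (simp flip: of_real_power)
    hence 1: "entire_theta q \<gamma> \<sigma> \<tau> n z ^ 2 = of_real (- \<tau> / real n) * poly q (argument n z) ^ 2"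
      by (simp add: entire_theta_argument power_mult_distrib)
    have "of_nat n * t_seq \<sigma> \<tau> n (of_real \<gamma> * z) = of_real (- \<tau>) * (1 - argument n z)"
      unfolding of_nat_mult_t_seq[OF n] using \<tau>_pos by (simp add: argument_def algebra_simps)
    hence 2: "t_seq \<sigma> \<tau> n (of_real \<gamma> * z) = of_real (- \<tau> / real n) * (1 - argument n z)"
      using n by (simp add: field_simps)
    show "entire_theta q \<gamma> \<sigma> \<tau> n z ^ 2 - t_seq \<sigma> \<tau> n (of_real \<gamma> * z)
        = of_real (- \<tau> / real n) * (argument n z ^ Suc L * poly r (argument n z))"
      unfolding 1 2 r'[symmetric] by (simp only: right_diff_distrib)
  qed
qed

lemma entire_phase_admissible:
  "admissible_phase a b ra rb \<gamma> \<sigma> \<alpha> \<beta> \<tau> \<rho> (cball 0 R) (\<lambda>z. z) (entire_theta q \<gamma> \<sigma> \<tau>) R (sqrt \<tau> / 2)"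
proof (unfold_locales)
  let ?K = "cball 0 R :: complex set"
  let ?\<theta> = "entire_theta q \<gamma> \<sigma> \<tau>"
  have bv: "uniform_bv ?K \<sigma> (\<lambda>n z. poly q (argument n z))"
    by (rule uniform_bv_poly[OF argument_bv])
  have \<psi>: "of_real (sqrt (real n)) * ?\<theta> n z = \<i> * of_real (sqrt \<tau>) * poly q (argument n z)" if "n \<ge> 1" for n z
    using that by (simp add: entire_theta_argument real_sqrt_divide)
  show "norm z \<le> R" if "z \<in> ?K" for z using that by simp
  show "\<exists>B. \<forall>z\<in>?K. norm (?\<theta> n z) \<le> B" for n
  proof -
    have "compact (?\<theta> n ` ?K)"
      by (intro compact_continuous_image holomorphic_on_imp_continuous_on holomorphic_intros) simp
    hence "bounded (?\<theta> n ` ?K)" by (rule compact_imp_bounded)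
    thus ?thesis unfolding bounded_iff by blast
  qed
  show "uniform_bigo ?K (1 / 2) ?\<theta>"
  proof -
    have "uniform_bigo ?K (1 / 2) (\<lambda>n z :: complex. of_real (sqrt (\<tau> / real n)))"
      using \<tau>_pos by (intro uniform_bigo_of_real) real_asymp
    moreover have "uniform_bigo ?K 0 (\<lambda>n z. poly q (argument n z))" using bv by (simp add: uniform_bv_def)
    ultimately have "uniform_bigo ?K (1 / 2) (\<lambda>n z. \<i> * (of_real (sqrt (\<tau> / real n)) * poly q (argument n z)))"
      by (intro uniform_bigo_cmult uniform_bigo_mult) auto
    thus ?thesis by (rule uniform_bigo_cong[where N = 0]) (simp add: entire_theta_argument)
  qed
  show "sqrt \<tau> / 2 > 0" using \<tau>_pos by simp
  show "\<forall>\<^sub>F n in sequentially. \<forall>z\<in>?K. sqrt \<tau> / 2 \<le> norm (of_real (sqrt (real n)) * ?\<theta> n z)"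
    using poly_argument_near_1 eventually_ge_at_top[of 1]
  proof eventually_elim
    case (elim n)
    show ?case
    proof
      fix z assume "z \<in> ?K"
      hence "1 / 2 \<le> norm (poly q (argument n z))"
        using elim(1) complex_Re_le_cmod order.trans by blast
      hence "sqrt \<tau> * (1 / 2) \<le> sqrt \<tau> * norm (poly q (argument n z))"
        using \<tau>_pos by (intro mult_left_mono) auto
      thus "sqrt \<tau> / 2 \<le> norm (of_real (sqrt (real n)) * ?\<theta> n z)"
        unfolding \<psi>[OF elim(2)] using \<tau>_pos by (simp add: norm_mult)
    qed
  qed
  have "uniform_bv ?K \<sigma> (\<lambda>n z. \<i> * of_real (sqrt \<tau>) * poly q (argument n z))"
    by (intro uniform_bv_mult uniform_bv_const bv)
  hence "uniform_bigo ?K \<sigma> (\<lambda>n z. \<i> * of_real (sqrt \<tau>) * poly q (argument (Suc n) z)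
      - \<i> * of_real (sqrt \<tau>) * poly q (argument n z))" by (simp add: uniform_bv_def)
  thus "uniform_bigo ?K \<sigma> (\<lambda>n z. of_real (sqrt (real (Suc n))) * ?\<theta> (Suc n) z - of_real (sqrt (real n)) * ?\<theta> n z)"
    by (rule uniform_bigo_cong[where N = 1]) (simp only: \<psi> le_SucI)
  show "uniform_bigo ?K (\<sigma> + 1 / 2) (\<lambda>n z. ?\<theta> n z ^ 2 - t_seq \<sigma> \<tau> n (of_real \<gamma> * z))"
    by (rule entire_theta_square)
  show "\<forall>\<^sub>F n in sequentially. \<forall>z\<in>?K. 0 \<le> Im (?\<theta> n z)"
    using poly_argument_near_1
  proof eventually_elim
    case (elim n)
    show ?case
    proof
      fix z assume "z \<in> ?K"
      hence "0 \<le> Re (poly q (argument n z))" using elim by fastforce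
      hence "0 \<le> sqrt (\<tau> / real n) * Re (poly q (argument n z))" using \<tau>_pos by simp
      thus "0 \<le> Im (?\<theta> n z)" by (simp add: Im_entire_theta)
    qed
  qed
qed

text \<open>
  For large \<open>n\<close> both \<open>\<theta>\<^sub>n\<close> and its entire substitute have nonnegative imaginary part, the latter at least
  \<open>(\<tau> / n)\<^sup>1\<^sup>/\<^sup>2 / 2\<close>, so they are as close as their squares allow.
\<close>

lemma theta_minus_entire_theta:
  "uniform_bigo (cball 0 R) \<sigma> (\<lambda>n z. theta \<sigma> \<tau> n (of_real \<gamma> * z) - entire_theta q \<gamma> \<sigma> \<tau> n z)"
proof -
  let ?P = "entire_theta q \<gamma> \<sigma> \<tau>"
  obtain C N where C: "C > 0" "\<And>n z. n \<ge> N \<Longrightarrow> z \<in> cball 0 R \<Longrightarrow>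
      norm (?P n z ^ 2 - t_seq \<sigma> \<tau> n (of_real \<gamma> * z)) \<le> C * real n powr (- (\<sigma> + 1 / 2))"
    by (rule uniform_bigoE[OF entire_theta_square]) blast
  obtain N' where N': "\<And>n z. n \<ge> N' \<Longrightarrow> z \<in> cball 0 R \<Longrightarrow> 1 / 2 \<le> Re (poly q (argument n z))"
    using poly_argument_near_1 unfolding eventually_sequentially by blast
  show ?thesis
  proof (rule uniform_bigoI[of "Max {N, N', 1}" _ _ "2 * C / sqrt \<tau>"])
    fix n z assume n: "Max {N, N', 1} \<le> n" and z: "z \<in> cball (0::complex) R"
    let ?\<theta> = "theta \<sigma> \<tau> n (of_real \<gamma> * z)"
    let ?s = "sqrt \<tau> / 2 * real n powr (- (1 / 2))"
    have n': "n \<ge> N" "n \<ge> N'" "n \<ge> 1" using n by auto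
    have s: "?s > 0" using \<tau>_pos n' by simp
    have "sqrt (\<tau> / real n) * (1 / 2) \<le> sqrt (\<tau> / real n) * Re (poly q (argument n z))"
      using N'[OF n'(2) z] \<tau>_pos by (intro mult_left_mono) auto
    moreover have "sqrt (\<tau> / real n) * (1 / 2) = ?s"
      using n' by (simp add: real_sqrt_divide powr_minus_divide powr_half_sqrt)
    ultimately have "?s \<le> Im (?P n z)" by (simp add: Im_entire_theta)
    moreover have "0 \<le> Im ?\<theta>" by (simp add: theta_def Im_branch_sqrt_nonneg)
    ultimately have "?s \<le> Im (?\<theta> + ?P n z)" by simp
    also have "\<dots> \<le> norm (?\<theta> + ?P n z)" using abs_Im_le_cmod[of "?\<theta> + ?P n z"] by linarith
    finally have "norm (?\<theta> - ?P n z) * ?s \<le> norm (?\<theta> - ?P n z) * norm (?\<theta> + ?P n z)"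
      by (intro mult_left_mono) auto
    also have "\<dots> = norm (?P n z ^ 2 - t_seq \<sigma> \<tau> n (of_real \<gamma> * z))"
    proof -
      have "?\<theta> ^ 2 = t_seq \<sigma> \<tau> n (of_real \<gamma> * z)" by (simp add: theta_def branch_sqrt_square)
      hence "(?\<theta> - ?P n z) * (?\<theta> + ?P n z) = - (?P n z ^ 2 - t_seq \<sigma> \<tau> n (of_real \<gamma> * z))"
        by (simp add: algebra_simps power2_eq_square)
      thus ?thesis by (metis norm_minus_cancel norm_mult)
    qed
    also have "\<dots> \<le> C * real n powr (- (\<sigma> + 1 / 2))" by (rule C(2)[OF n'(1) z])
    also have "\<dots> = 2 * C / sqrt \<tau> * real n powr (- \<sigma>) * ?s"
      using \<tau>_pos powr_add[of "real n" "- \<sigma>" "- (1 / 2)"] by simp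
    finally show "norm (?\<theta> - ?P n z) \<le> 2 * C / sqrt \<tau> * real n powr (- \<sigma>)"
      using s mult_le_cancel_right_pos by blast
  qed
qed

end

lemma holomorphic_on_theta_ball:
  assumes \<tau>_pos: "\<tau> > 0" and N: "N \<ge> 1" "\<tau> * real N powr (\<sigma> - 1) > R" "n \<ge> N"
  shows "(\<lambda>z. theta \<sigma> \<tau> n (of_real \<gamma> * z)) holomorphic_on ball 0 R"
proof -
  have n: "n \<ge> 1" using N by simp
  have "t_seq \<sigma> \<tau> n (of_real \<gamma> * z) \<in> - \<real>\<^sub>\<ge>\<^sub>0" if z: "z \<in> ball 0 R" for z :: complex
  proof -
    have "R < \<tau> * real n powr (\<sigma> - 1)"
    proof -
      have "real N powr (\<sigma> - 1) \<le> real n powr (\<sigma> - 1)" using N \<sigma> by (intro powr_mono2) auto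
      thus ?thesis using N(2) \<tau>_pos mult_left_mono[of "real N powr (\<sigma> - 1)" "real n powr (\<sigma> - 1)" \<tau>] by linarith
    qed
    moreover have "\<bar>\<gamma> * Re z\<bar> < R" using z abs_Re_le_cmod[of z] \<gamma>_abs by (simp add: abs_mult)
    ultimately have "\<gamma> * Re z < \<tau> * real n powr (\<sigma> - 1)" by linarith
    hence "\<gamma> * Re z * real n powr (- \<sigma>) < \<tau> * real n powr (\<sigma> - 1) * real n powr (- \<sigma>)"
      using n by (intro mult_strict_right_mono) auto
    also have "\<dots> = \<tau> / real n"
    proof -
      have "real n powr (\<sigma> - 1) * real n powr (- \<sigma>) = real n powr (- 1)" by (simp flip: powr_add)
      also have "\<dots> = 1 / real n" using n by (simp add: powr_minus_divide)
      finally show ?thesis by (simp add: mult.assoc)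
    qed
    finally have "Re (t_seq \<sigma> \<tau> n (of_real \<gamma> * z)) < 0"
      by (simp add: t_seq_def Re_divide_of_nat)
    thus ?thesis by (auto simp: complex_nonneg_Reals_iff)
  qed
  moreover have "(\<lambda>z. t_seq \<sigma> \<tau> n (of_real \<gamma> * z)) holomorphic_on ball 0 R"
    unfolding t_seq_def by (intro holomorphic_intros)
  ultimately have "(branch_sqrt \<circ> (\<lambda>z. t_seq \<sigma> \<tau> n (of_real \<gamma> * z))) holomorphic_on ball 0 R"
    by (intro holomorphic_on_compose_gen[OF _ holomorphic_branch_sqrt]) auto
  thus ?thesis by (simp add: o_def theta_def)
qed

text \<open>
  The series of \<open>\<theta>\<^sub>m\<close> minus its entire substitute converges where the \<open>\<theta>\<^sub>m\<close> with \<open>m \<ge> N\<close> are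
  analytic, which is why \<open>C\<close> is the exponential of an analytic function there.  The solution itself
  is built from the substitutes only, and so depends neither on the disc nor on \<open>N\<close>.
\<close>

theorem entire_solution:
  assumes \<tau>_pos: "\<tau> > 0"
  obtains f :: "nat \<Rightarrow> complex \<Rightarrow> complex" where
    "\<And>z. jacobi_solution a b z (\<lambda>n. f n z)" "\<And>n. f n holomorphic_on UNIV"
    "\<And>R N. R > 0 \<Longrightarrow> N \<ge> 1 \<Longrightarrow> \<tau> * real N powr (\<sigma> - 1) > R \<Longrightarrow>
       \<exists>C. C holomorphic_on ball 0 R \<and> (\<forall>z\<in>ball 0 R. C z \<noteq> 0) \<and>
         (\<forall>K. compact K \<and> K \<subseteq> ball 0 R \<longrightarrow> asymptotic_uniformly_on K f
            (\<lambda>n z. C z * ansatz \<gamma> \<rho> n (\<Sum>m=N..n. theta \<sigma> \<tau> m (of_real \<gamma> * z))))"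
proof -
  \<comment> \<open>A remainder \<open>x ^ Suc l\<close> with \<open>x = O(n powr (1 - \<sigma>))\<close> is then small enough for an admissible phase.\<close>
  obtain l where "\<sigma> - 1 / 2 < real l * (\<sigma> - 1)" using \<sigma> reals_Archimedean3[of "\<sigma> - 1"] by auto
  moreover have "real l * (\<sigma> - 1) \<le> real (Suc l) * (\<sigma> - 1)" using \<sigma> by (intro mult_right_mono) auto
  ultimately have L: "\<sigma> - 1 / 2 \<le> real (Suc l) * (\<sigma> - 1)" by linarith
  obtain q :: "complex poly" where q: "poly q 0 = 1" "[:0, 1:] ^ Suc l dvd q ^ 2 - [:1, - 1:]"
    by (rule approximate_sqrt_polynomial)
  define P where "P = entire_theta q \<gamma> \<sigma> \<tau>"
  define A where "A = (\<lambda>n z. ansatz \<gamma> \<rho> n (\<Sum>m=1..n. P m z))"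
  define T where "T = (\<lambda>n M z. truncated_solution a b z (\<lambda>n. A n z) M n)"
  define f where "f = (\<lambda>n z. lim (\<lambda>M. T n M z))"
  have main: "uniform_limit (cball 0 R) (T n) (f n) sequentially"
      "\<forall>z\<in>cball 0 R. jacobi_solution a b z (\<lambda>n. f n z)" "asymptotic_uniformly_on (cball 0 R) f A" for R n
  proof -
    interpret admissible_phase a b ra rb \<gamma> \<sigma> \<alpha> \<beta> \<tau> \<rho> "cball 0 R" "\<lambda>z. z" P R "sqrt \<tau> / 2"
      unfolding P_def by (rule entire_phase_admissible[OF \<tau>_pos L q])
    have A': "A = approx" by (simp add: fun_eq_iff A_def approx_def phase_def)
    show "uniform_limit (cball 0 R) (T n) (f n) sequentially"
      using phase_solution(1)[of n] unfolding f_def T_def A' uniformly_convergent_uniform_limit_iff .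
    show "\<forall>z\<in>cball 0 R. jacobi_solution a b z (\<lambda>n. f n z)" "asymptotic_uniformly_on (cball 0 R) f A"
      using phase_solution(2,3) unfolding f_def T_def A' by blast+
  qed
  show thesis
  proof (rule that[of f])
    show "jacobi_solution a b z (\<lambda>n. f n z)" for z using main(2)[of "norm z"] by simp
    have "A n holomorphic_on UNIV" for n
      unfolding A_def ansatz_def P_def by (intro holomorphic_intros)
    hence T_hol: "T n M holomorphic_on UNIV" for n M
      unfolding T_def by (intro holomorphic_on_truncated_solution a_pos holomorphic_intros)
    show "f n holomorphic_on UNIV" for n
    proof (rule holomorphic_uniform_sequence[OF open_UNIV T_hol])
      fix z :: complex
      have "cball z 1 \<subseteq> cball 0 (norm z + 1)"
      proof
        fix w assume "w \<in> cball z 1"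
        thus "w \<in> cball 0 (norm z + 1)"
          using norm_triangle_ineq2[of w z] by (simp add: dist_norm norm_minus_commute)
      qed
      hence "uniform_limit (cball z 1) (T n) (f n) sequentially"
        by (rule uniform_limit_on_subset[OF main(1)])
      thus "\<exists>d>0. cball z d \<subseteq> UNIV \<and> uniform_limit (cball z d) (T n) (f n) sequentially"
        by (intro exI[of _ 1]) auto
    qed
    fix R :: real and N :: nat
    assume R: "R > 0" and N: "N \<ge> 1" "\<tau> * real N powr (\<sigma> - 1) > R"
    \<comment> \<open>Below \<open>N\<close> the square roots need not be analytic on the disc; of these terms only the substitutes \<open>P\<close> enter \<open>C\<close>.\<close>
    define D where "D = (\<lambda>m z. if m < N then 0 else theta \<sigma> \<tau> m (of_real \<gamma> * z) - P m z)"
    define E where "E = (\<lambda>z. \<Sum>m. D m z)"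
    have "uniform_bigo (cball 0 R) \<sigma> (\<lambda>n z. theta \<sigma> \<tau> n (of_real \<gamma> * z) - P n z)"
      unfolding P_def by (rule theta_minus_entire_theta[OF \<tau>_pos L q])
    then obtain B N' where B: "\<And>n z. n \<ge> N' \<Longrightarrow> z \<in> cball 0 R \<Longrightarrow>
        norm (theta \<sigma> \<tau> n (of_real \<gamma> * z) - P n z) \<le> B * real n powr (- \<sigma>)"
      by (rule uniform_bigoE) blast
    have E_lim: "uniform_limit (cball 0 R) (\<lambda>n z. \<Sum>m<n. D m z) E sequentially"
      unfolding E_def
    proof (rule Weierstrass_m_test_ev)
      have "\<forall>z\<in>cball 0 R. norm (D n z) \<le> B * real n powr (- \<sigma>)" if "n \<ge> max N N'" for n
        using B[of n] that by (simp add: D_def)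
      thus "\<forall>\<^sub>F n in sequentially. \<forall>z\<in>cball 0 R. norm (D n z) \<le> B * real n powr (- \<sigma>)"
        unfolding eventually_sequentially by blast
      show "summable (\<lambda>n. B * real n powr (- \<sigma>))"
        using \<sigma> by (intro summable_mult) (simp add: summable_real_powr_iff)
    qed
    have D_hol: "D m holomorphic_on ball 0 R" for m
    proof (cases "m < N")
      case False
      thus ?thesis unfolding D_def P_def
        by (auto intro!: holomorphic_intros holomorphic_on_theta_ball[OF \<tau>_pos N])
    qed (simp add: D_def)
    have E_hol: "E holomorphic_on ball 0 R"
    proof (rule holomorphic_uniform_sequence[OF open_ball])
      show "(\<lambda>z. \<Sum>m<n. D m z) holomorphic_on ball 0 R" for n by (intro holomorphic_intros D_hol)
      fix z assume "z \<in> ball (0::complex) R"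
      then obtain d where d: "d > 0" "cball z d \<subseteq> ball 0 R"
        using open_contains_cball open_ball by blast
      hence "cball z d \<subseteq> cball 0 R" using ball_subset_cball by blast
      hence "uniform_limit (cball z d) (\<lambda>n z. \<Sum>m<n. D m z) E sequentially"
        by (rule uniform_limit_on_subset[OF E_lim])
      thus "\<exists>d>0. cball z d \<subseteq> ball 0 R \<and> uniform_limit (cball z d) (\<lambda>n z. \<Sum>m<n. D m z) E sequentially"
        using d by blast
    qed
    define C where "C = (\<lambda>z. exp (\<i> * ((\<Sum>m=1..<N. P m z) - E z)))"
    define \<delta> where "\<delta> = (\<lambda>n z. \<i> * (E z - (\<Sum>m<Suc n. D m z)))"
    have "uniform_limit (cball 0 R) (\<lambda>n z. \<Sum>m<Suc n. D m z) E sequentially"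
      using E_lim by (rule filterlim_compose[OF _ filterlim_Suc])
    hence \<delta>: "uniform_limit (cball 0 R) \<delta> (\<lambda>_. 0) sequentially"
      unfolding uniform_limit_iff by (simp add: \<delta>_def dist_norm norm_mult norm_minus_commute)
    have A_eq: "A n z = (C z * ansatz \<gamma> \<rho> n (\<Sum>m=N..n. theta \<sigma> \<tau> m (of_real \<gamma> * z))) * exp (\<delta> n z)"
      if n: "n \<ge> N" for n z
    proof -
      have "(\<Sum>m<Suc n. D m z) = (\<Sum>m=N..n. D m z)"
        by (intro sum.mono_neutral_right) (auto simp: D_def)
      also have "\<dots> = (\<Sum>m=N..n. theta \<sigma> \<tau> m (of_real \<gamma> * z)) - (\<Sum>m=N..n. P m z)"
        unfolding sum_subtractf[symmetric] by (intro sum.cong) (auto simp: D_def)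
      finally have 1: "(\<Sum>m<Suc n. D m z) = (\<Sum>m=N..n. theta \<sigma> \<tau> m (of_real \<gamma> * z)) - (\<Sum>m=N..n. P m z)" .
      have "{1..n} = {1..<N} \<union> {N..n}" using n N(1) by auto
      hence 2: "(\<Sum>m=1..n. P m z) = (\<Sum>m=1..<N. P m z) + (\<Sum>m=N..n. P m z)"
        by (simp only:) (subst sum.union_disjoint, auto)
      have 3: "exp (\<i> * (u + v)) = exp (\<i> * (u - e)) * exp (\<i> * t) * exp (\<i> * (e - (t - v)))" for u v e t :: complex
        unfolding exp_add[symmetric] by (simp add: algebra_simps)
      show ?thesis
        unfolding A_def ansatz_def C_def \<delta>_def 1 2
          3[where e = "E z" and t = "\<Sum>m=N..n. theta \<sigma> \<tau> m (of_real \<gamma> * z)"]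
        by (simp only: mult_ac)
    qed
    have as: "asymptotic_uniformly_on (cball 0 R) f
        (\<lambda>n z. C z * ansatz \<gamma> \<rho> n (\<Sum>m=N..n. theta \<sigma> \<tau> m (of_real \<gamma> * z)))"
      by (rule asymptotic_uniformly_on_exp_null[OF main(3) \<delta>]) (rule A_eq)
    show "\<exists>C. C holomorphic_on ball 0 R \<and> (\<forall>z\<in>ball 0 R. C z \<noteq> 0) \<and>
         (\<forall>K. compact K \<and> K \<subseteq> ball 0 R \<longrightarrow> asymptotic_uniformly_on K f
            (\<lambda>n z. C z * ansatz \<gamma> \<rho> n (\<Sum>m=N..n. theta \<sigma> \<tau> m (of_real \<gamma> * z))))"
    proof (intro exI[of _ C] conjI allI impI ballI)
      show "C holomorphic_on ball 0 R" unfolding C_def P_def by (intro holomorphic_intros E_hol)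
      show "C z \<noteq> 0" for z by (simp add: C_def)
      fix K assume "compact K \<and> K \<subseteq> ball (0::complex) R"
      hence "K \<subseteq> cball 0 R" using ball_subset_cball by blast
      thus "asymptotic_uniformly_on K f
          (\<lambda>n z. C z * ansatz \<gamma> \<rho> n (\<Sum>m=N..n. theta \<sigma> \<tau> m (of_real \<gamma> * z)))"
        by (rule asymptotic_uniformly_on_subset[OF as])
    qed
  qed
qed

end

section \<open>Asymptotics of the solutions in the critical case\<close>

theorem theorem2p1:
  fixes a b ra rb :: "nat \<Rightarrow> real" and \<gamma> \<sigma> \<alpha> \<beta> \<tau> \<rho> :: real
  assumes "\<gamma> \<in> {1, - 1}" and "\<sigma> \<in> {1<..3/2}"
    and "\<And>n. a n > 0"
    and "\<And>n. n \<ge> 1 \<Longrightarrow> a n = real n powr \<sigma> * (1 + \<alpha> / real n + ra n)"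
    and "ra \<in> O(\<lambda>n. 1 / real n ^ 2)"
    and "\<And>n. n \<ge> 1 \<Longrightarrow> b n = 2 * \<gamma> * real n powr \<sigma> * (1 + \<beta> / real n + rb n)"
    and "rb \<in> O(\<lambda>n. 1 / real n ^ 2)"
    and "\<tau> = 2 * \<beta> - 2 * \<alpha> + \<sigma>" and "\<tau> \<noteq> 0"
    and "\<rho> = \<sigma> / 2 - 1 / 4"
  shows
    "(\<tau> < 0 \<longrightarrow>
       (\<exists>f :: nat \<Rightarrow> bool \<times> complex \<Rightarrow> complex.
          (\<forall>p\<in>closed_cut_plane. jacobi_solution a b (snd p) (\<lambda>n. f n p)) \<and>
          (\<forall>n. analytic_continuous_up_to_cut (f n)) \<and>
          (\<forall>K. compact K \<and> K \<subseteq> closed_cut_plane \<longrightarrow>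
             asymptotic_uniformly_on K f
               (\<lambda>n p. ansatz \<gamma> \<rho> n (\<Sum>m=1..n. theta_cut \<sigma> \<tau> m (cut_mult \<gamma> p)))))) \<and>
     (\<tau> > 0 \<longrightarrow>
       (\<exists>f :: nat \<Rightarrow> complex \<Rightarrow> complex.
          (\<forall>z. jacobi_solution a b z (\<lambda>n. f n z)) \<and>
          (\<forall>n. f n holomorphic_on UNIV) \<and>
          (\<forall>R N. R > 0 \<and> N \<ge> 1 \<and> \<tau> * real N powr (\<sigma> - 1) > R \<longrightarrow>
             (\<exists>C. C holomorphic_on ball 0 R \<and> (\<forall>z\<in>ball 0 R. C z \<noteq> 0) \<and>
                (\<forall>K. compact K \<and> K \<subseteq> ball 0 R \<longrightarrow>
                   asymptotic_uniformly_on K f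
                     (\<lambda>n z. C z *
                        ansatz \<gamma> \<rho> n (\<Sum>m=N..n. theta \<sigma> \<tau> m (of_real \<gamma> * z))))))))"
proof -
  interpret critical_jacobi a b ra rb \<gamma> \<sigma> \<alpha> \<beta> \<tau> \<rho>
    by unfold_locales (use assms in \<open>auto simp only: greaterThanAtMost_iff\<close>)
  show ?thesis
  proof (intro conjI impI)
    assume \<tau>: "\<tau> < 0"
    show "\<exists>f :: nat \<Rightarrow> bool \<times> complex \<Rightarrow> complex.
          (\<forall>p\<in>closed_cut_plane. jacobi_solution a b (snd p) (\<lambda>n. f n p)) \<and>
          (\<forall>n. analytic_continuous_up_to_cut (f n)) \<and>
          (\<forall>K. compact K \<and> K \<subseteq> closed_cut_plane \<longrightarrow>
             asymptotic_uniformly_on K f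
               (\<lambda>n p. ansatz \<gamma> \<rho> n (\<Sum>m=1..n. theta_cut \<sigma> \<tau> m (cut_mult \<gamma> p))))"
      by (intro exI conjI ballI allI impI; (elim conjE)?; rule solution_up_to_cut[OF \<tau>]; assumption)
  next
    assume \<tau>: "\<tau> > 0"
    obtain f :: "nat \<Rightarrow> complex \<Rightarrow> complex" where f:
      "\<And>z. jacobi_solution a b z (\<lambda>n. f n z)" "\<And>n. f n holomorphic_on UNIV"
      "\<And>R N. R > 0 \<Longrightarrow> N \<ge> 1 \<Longrightarrow> \<tau> * real N powr (\<sigma> - 1) > R \<Longrightarrow>
         \<exists>C. C holomorphic_on ball 0 R \<and> (\<forall>z\<in>ball 0 R. C z \<noteq> 0) \<and>
           (\<forall>K. compact K \<and> K \<subseteq> ball 0 R \<longrightarrow> asymptotic_uniformly_on K f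
              (\<lambda>n z. C z * ansatz \<gamma> \<rho> n (\<Sum>m=N..n. theta \<sigma> \<tau> m (of_real \<gamma> * z))))"
      by (rule entire_solution[OF \<tau>]) blast
    show "\<exists>f :: nat \<Rightarrow> complex \<Rightarrow> complex.
          (\<forall>z. jacobi_solution a b z (\<lambda>n. f n z)) \<and>
          (\<forall>n. f n holomorphic_on UNIV) \<and>
          (\<forall>R N. R > 0 \<and> N \<ge> 1 \<and> \<tau> * real N powr (\<sigma> - 1) > R \<longrightarrow>
             (\<exists>C. C holomorphic_on ball 0 R \<and> (\<forall>z\<in>ball 0 R. C z \<noteq> 0) \<and>
                (\<forall>K. compact K \<and> K \<subseteq> ball 0 R \<longrightarrow>
                   asymptotic_uniformly_on K f
                     (\<lambda>n z. C z *
                        ansatz \<gamma> \<rho> n (\<Sum>m=N..n. theta \<sigma> \<tau> m (of_real \<gamma> * z))))))"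
      by (rule exI[of _ f]) (intro conjI allI impI f; elim conjE; assumption)
  qed
qed

end
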